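(* Let $n \ge 4$ be an integer, let $\Gamma$ be a nontrivial finite group, and let $M$ be a lift of the cycle matroid $M(K_n^{\Gamma})$ such that a cycle of $K_n^{\Gamma}$ is a circuit of $M$ if and only if it is balanced. If $r(M) - r(M(K_n^{\Gamma})) > 1$, then there are a prime $p$ and an integer $j \ge 2$ such that $\Gamma \cong \mathbb{Z}_p^j$.
   Context: For a finite group $\Gamma$ with identity $\epsilon$ and integer $n$, $K_n^{\Gamma}$ is the graph with vertex set $[n]$ and edge set $\binom{[n]}{2}\times\Gamma$; the edge $(\{i,j\},\alpha)$ with $i<j$ is oriented from $i$ to $j$ and labeled $\alpha$. A cycle (including a $2$-edge cycle of two parallel edges) is balanced if, traversing it cyclically and multiplying the labels, using $\alpha$ for an edge traversed along its orientation and $\alpha^{-1}$ for one traversed against it, the product is $\epsilon$. $M(K_n^\Gamma)$ is the cycle matroid of $K_n^\Gamma$. Given matroids $M, L$ on a common ground set $E$, $L$ is a lift of $M$ if there is a matroid $K$ on $E\cup F$ with $M=K/F$ and $L=K\setminus F$. $r(\cdot)$ denotes the rank of a matroid; $\mathbb{Z}_p^j$ is the direct sum of $j$ copies of the cyclic group of order $p$. *)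

theory Defs
  imports
    "HOL-Algebra.Product_Groups"
    "HOL-Computational_Algebra.Primes"
    "Graph_Theory.Digraph"
begin

section \<open>Matroids\<close>

text \<open>Finite matroids, given by their independent sets. Since \<open>indeps\<close> contains only subsets of
  \<open>ground\<close>, equality of records is equality of matroids.\<close>

record 'e pre_matroid =
  ground :: "'e set"
  indeps :: "'e set set"

locale matroid =
  fixes M :: "'e pre_matroid"
  assumes finite_ground: "finite (ground M)"
    and indep_subset_ground: "I \<in> indeps M \<Longrightarrow> I \<subseteq> ground M"
    and indep_empty: "{} \<in> indeps M"
    and indep_subset: "I \<in> indeps M \<Longrightarrow> J \<subseteq> I \<Longrightarrow> J \<in> indeps M"
    and indep_augment: "I \<in> indeps M \<Longrightarrow> J \<in> indeps M \<Longrightarrow> card I < card J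
      \<Longrightarrow> \<exists>x \<in> J - I. insert x I \<in> indeps M"

definition circuit :: "'e pre_matroid \<Rightarrow> 'e set \<Rightarrow> bool" where
  "circuit M C \<longleftrightarrow> C \<subseteq> ground M \<and> C \<notin> indeps M \<and> (\<forall>D. D \<subset> C \<longrightarrow> D \<in> indeps M)"

definition basis_of :: "'e pre_matroid \<Rightarrow> 'e set \<Rightarrow> 'e set \<Rightarrow> bool" where
  "basis_of M X B \<longleftrightarrow> B \<subseteq> X \<and> B \<in> indeps M \<and>
     (\<forall>I. I \<in> indeps M \<longrightarrow> I \<subseteq> X \<longrightarrow> B \<subseteq> I \<longrightarrow> I = B)"

definition matroid_rank :: "'e pre_matroid \<Rightarrow> nat" where
  "matroid_rank M = Max (card ` indeps M)"

definition deletion :: "'e pre_matroid \<Rightarrow> 'e set \<Rightarrow> 'e pre_matroid" where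
  "deletion M F = \<lparr>ground = ground M - F, indeps = {I \<in> indeps M. I \<subseteq> ground M - F}\<rparr>"

text \<open>In a matroid it does not matter which basis of \<open>F\<close> is taken.\<close>

definition contraction :: "'e pre_matroid \<Rightarrow> 'e set \<Rightarrow> 'e pre_matroid" where
  "contraction M F = \<lparr>ground = ground M - F,
     indeps = {I. I \<subseteq> ground M - F \<and> (\<exists>B. basis_of M F B \<and> I \<union> B \<in> indeps M)}\<rparr>"

text \<open>The new elements \<open>F\<close> are taken from the type of the ground set. This is no restriction for an
  infinite type, such as the edge type \<open>nat set \<times> 'a\<close> used below, because \<open>ground K\<close> is finite.\<close>

definition is_lift :: "'e pre_matroid \<Rightarrow> 'e pre_matroid \<Rightarrow> bool" where
  "is_lift L M \<longleftrightarrow> matroid L \<and> matroid M \<and> ground L = ground M \<and>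
     (\<exists>K F. matroid K \<and> ground K = ground M \<union> F \<and> ground M \<inter> F = {} \<and>
        M = contraction K F \<and> L = deletion K F)"


section \<open>Cycles of oriented multigraphs and the cycle matroid\<close>

text \<open>Arcs are edges with a reference orientation, which cycles need not respect. The step
  \<open>(e, True)\<close> traverses \<open>e\<close> from tail to head and \<open>(e, False)\<close> from head to tail.\<close>

fun step_start :: "('v, 'e) pre_digraph \<Rightarrow> 'e \<times> bool \<Rightarrow> 'v" where
  "step_start G (e, d) = (if d then tail G e else head G e)"

fun step_end :: "('v, 'e) pre_digraph \<Rightarrow> 'e \<times> bool \<Rightarrow> 'v" where
  "step_end G (e, d) = (if d then head G e else tail G e)"

text \<open>Distinctness of the edges only matters for length two: it excludes going back and
  forth along a single edge, and leaves two parallel edges.\<close>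

definition cycle_traversal :: "('v, 'e) pre_digraph \<Rightarrow> ('e \<times> bool) list \<Rightarrow> bool" where
  "cycle_traversal G w \<longleftrightarrow> w \<noteq> [] \<and> set (map fst w) \<subseteq> arcs G \<and>
     distinct (map fst w) \<and> distinct (map (step_start G) w) \<and>
     (\<forall>k < length w. step_end G (w ! k) = step_start G (w ! (Suc k mod length w)))"

definition is_cycle :: "('v, 'e) pre_digraph \<Rightarrow> 'e set \<Rightarrow> bool" where
  "is_cycle G C \<longleftrightarrow> (\<exists>w. cycle_traversal G w \<and> C = set (map fst w))"

definition cycle_matroid :: "('v, 'e) pre_digraph \<Rightarrow> 'e pre_matroid" where
  "cycle_matroid G = \<lparr>ground = arcs G, indeps = {I. I \<subseteq> arcs G \<and> \<not> (\<exists>C \<subseteq> I. is_cycle G C)}\<rparr>"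


section \<open>The group-labelled complete graph\<close>

definition group_complete_graph ::
    "nat \<Rightarrow> ('a, 'b) monoid_scheme \<Rightarrow> (nat, nat set \<times> 'a) pre_digraph" where
  "group_complete_graph n \<Gamma> =
     \<lparr>verts = {1..n},
      arcs = {s. s \<subseteq> {1..n} \<and> card s = 2} \<times> carrier \<Gamma>,
      tail = (\<lambda>(s, \<alpha>). Min s),
      head = (\<lambda>(s, \<alpha>). Max s)\<rparr>"

fun step_label :: "('a, 'b) monoid_scheme \<Rightarrow> (nat set \<times> 'a) \<times> bool \<Rightarrow> 'a" where
  "step_label \<Gamma> ((s, \<alpha>), d) = (if d then \<alpha> else inv\<^bsub>\<Gamma>\<^esub> \<alpha>)"

definition traversal_product :: "('a, 'b) monoid_scheme \<Rightarrow> ((nat set \<times> 'a) \<times> bool) list \<Rightarrow> 'a" where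
  "traversal_product \<Gamma> w = foldr (\<lambda>x y. x \<otimes>\<^bsub>\<Gamma>\<^esub> y) (map (step_label \<Gamma>) w) \<one>\<^bsub>\<Gamma>\<^esub>"

text \<open>Changing the starting point or the direction of the traversal conjugates or inverts the
  product, so whether it is the identity depends on the cycle only.\<close>

definition balanced :: "nat \<Rightarrow> ('a, 'b) monoid_scheme \<Rightarrow> (nat set \<times> 'a) set \<Rightarrow> bool" where
  "balanced n \<Gamma> C \<longleftrightarrow> (\<exists>w. cycle_traversal (group_complete_graph n \<Gamma>) w \<and>
     C = set (map fst w) \<and> traversal_product \<Gamma> w = \<one>\<^bsub>\<Gamma>\<^esub>)"

end

theory Submission
  imports
    Defs
    "HOL-Algebra.Free_Abelian_Groups"
    "HOL-Algebra.Multiplicative_Group"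
    "HOL-Number_Theory.Cong"
begin

text \<open>For \<open>A \<subseteq> \<Gamma>\<close> let \<open>R A\<close> be the rank in \<open>M\<close> of the edges from \<open>i\<close> to \<open>j\<close> with label in \<open>A\<close>.
  Adding an edge across a cut that no edge of a set crosses raises the rank of the set by one, and
  balanced triangles are circuits. Hence \<open>R\<close> does not depend on \<open>i\<close> and \<open>j\<close>, is invariant under
  translations, and is the rank function of a simple matroid on \<open>\<Gamma>\<close>, of rank
  \<open>r(M) - r(M(K_n)) + 1 \<ge> 3\<close>. The lines of this matroid through \<open>\<epsilon>\<close> partition
  \<open>\<Gamma> - {\<epsilon>}\<close>. Closing up the edges with label in \<open>A\<close> on a triangle gives
  \<open>R (A\<^sup>-\<^sup>1 A) \<le> R A\<close>, so these lines are subgroups; on four vertices one gets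
  \<open>R (g A \<union> A g) \<le> R A\<close> for \<open>\<epsilon> \<in> A\<close>, so they are normal. A finite group with a partition into
  proper normal subgroups is elementary abelian: elements of different components commute,
  and all elements have the same prime order.\<close>

section \<open>Rank and closure in matroids\<close>

context matroid
begin

definition rk :: "'e set \<Rightarrow> nat" where
  "rk X = Max (card ` {I \<in> indeps M. I \<subseteq> X})"

text \<open>Elements outside the ground set behave as loops and lie in every closure. A subset of a
  closure may thus be infinite, while the induction in \<open>rk_Un_cl\<close> runs over a finite
  one.\<close>

definition cl :: "'e set \<Rightarrow> 'e set" where
  "cl X = {e. rk (insert e X) = rk X}"

lemma finite_indeps: "finite (indeps M)"
  by (rule finite_subset[of _ "Pow (ground M)"]) (auto dest: indep_subset_ground simp: finite_ground)

lemma finite_indep: "I \<in> indeps M \<Longrightarrow> finite I"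
  using finite_ground indep_subset_ground finite_subset by blast

lemma card_le_rk: "I \<in> indeps M \<Longrightarrow> I \<subseteq> X \<Longrightarrow> card I \<le> rk X"
  unfolding rk_def by (rule Max_ge) (auto simp: finite_indeps)

lemma rk_witness: obtains I where "I \<in> indeps M" "I \<subseteq> X" "card I = rk X"
proof -
  have "rk X \<in> card ` {I \<in> indeps M. I \<subseteq> X}"
    unfolding rk_def using indep_empty by (intro Max_in) (auto simp: finite_indeps)
  then show ?thesis using that by auto
qed

text \<open>A largest independent set between \<open>I\<close> and \<open>X\<close> already reaches
  the rank, as otherwise augmentation from a maximum independent subset of \<open>X\<close> would
  enlarge it.\<close>

lemma indep_extend:
  assumes "I \<in> indeps M" "I \<subseteq> X"
  obtains J where "J \<in> indeps M" "I \<subseteq> J" "J \<subseteq> X" "card J = rk X"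
proof -
  let ?S = "{J \<in> indeps M. I \<subseteq> J \<and> J \<subseteq> X}"
  have fin: "finite ?S" using finite_indeps by simp
  have "I \<in> ?S" using assms by simp
  then have "Max (card ` ?S) \<in> card ` ?S" using fin by (intro Max_in) auto
  then obtain J where J: "J \<in> ?S" "card J = Max (card ` ?S)" by fastforce
  obtain K where K: "K \<in> indeps M" "K \<subseteq> X" "card K = rk X" by (rule rk_witness)
  have "\<not> card J < card K"
  proof
    assume "card J < card K"
    then obtain x where x: "x \<in> K - J" "insert x J \<in> indeps M"
      using indep_augment J(1) K(1) by blast
    then have "insert x J \<in> ?S" using J(1) K(2) by auto
    then have "card (insert x J) \<le> card J" unfolding J(2) using fin by (intro Max_ge) auto
    with x finite_indep J(1) show False by simp
  qed
  then have "card J = rk X" using card_le_rk[of J X] J(1) K(3) by auto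
  then show ?thesis using J(1) that by auto
qed

lemma rk_mono: "X \<subseteq> Y \<Longrightarrow> rk X \<le> rk Y"
  unfolding rk_def using indep_empty by (intro Max_mono) (auto simp: finite_indeps)

lemma rk_indep: "I \<in> indeps M \<Longrightarrow> rk I = card I"
proof (rule order_antisym)
  assume I: "I \<in> indeps M"
  obtain J where "J \<subseteq> I" "card J = rk I" by (rule rk_witness)
  then show "rk I \<le> card I" using card_mono[OF finite_indep[OF I]] by metis
qed (simp add: card_le_rk)

text \<open>Extend a basis of the intersection to a basis \<open>J\<close> of the union and count
  \<open>J\<close> by inclusion and exclusion on \<open>X\<close> and \<open>Y\<close>.\<close>

lemma rk_submodular: "rk (X \<union> Y) + rk (X \<inter> Y) \<le> rk X + rk Y"
proof -
  obtain I where I: "I \<in> indeps M" "I \<subseteq> X \<inter> Y" "card I = rk (X \<inter> Y)" by (rule rk_witness)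
  obtain J where J: "J \<in> indeps M" "I \<subseteq> J" "J \<subseteq> X \<union> Y" "card J = rk (X \<union> Y)"
    using indep_extend[OF I(1), of "X \<union> Y"] I(2) by auto
  have fin: "finite J" by (rule finite_indep[OF J(1)])
  have "(J \<inter> X) \<union> (J \<inter> Y) = J" using J(3) by auto
  then have "card J + card (J \<inter> X \<inter> (J \<inter> Y)) = card (J \<inter> X) + card (J \<inter> Y)"
    using card_Un_Int[of "J \<inter> X" "J \<inter> Y"] fin by simp
  moreover have "card I \<le> card (J \<inter> X \<inter> (J \<inter> Y))"
    using I(2) J(2) fin by (intro card_mono) auto
  moreover have "card (J \<inter> X) \<le> rk X" "card (J \<inter> Y) \<le> rk Y"
    using indep_subset[OF J(1)] by (auto intro: card_le_rk)
  ultimately show ?thesis using I J by linarith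
qed

lemma rk_insert_le: "rk (insert e X) \<le> Suc (rk X)"
proof -
  obtain I where I: "I \<in> indeps M" "I \<subseteq> insert e X" "card I = rk (insert e X)" by (rule rk_witness)
  have "card (I - {e}) \<le> rk X"
    using I by (intro card_le_rk) (auto intro: indep_subset)
  moreover have "card I \<le> Suc (card (I - {e}))" using card_Suc_Diff1[OF finite_indep[OF I(1)]]
    by (cases "e \<in> I") auto
  ultimately show ?thesis using I by simp
qed

text \<open>The form in which submodularity is used: marginal ranks shrink as the set grows.\<close>

lemma rk_Un_insert_le: "X \<subseteq> Y \<Longrightarrow> rk (insert e Y) + rk X \<le> rk Y + rk (insert e X)"
proof (cases "e \<in> Y")
  case True
  assume "X \<subseteq> Y"
  then show ?thesis using True rk_mono[of X "insert e X"] by (simp add: insert_absorb subset_insertI)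
next
  case False
  assume "X \<subseteq> Y"
  then have "insert e Y = Y \<union> insert e X" "Y \<inter> insert e X = X" using False by auto
  then show ?thesis using rk_submodular[of Y "insert e X"] by simp
qed

lemma cl_mono: "X \<subseteq> Y \<Longrightarrow> cl X \<subseteq> cl Y"
proof
  fix e assume "X \<subseteq> Y" "e \<in> cl X"
  then have "rk (insert e Y) \<le> rk Y" using rk_Un_insert_le[of X Y e] by (simp add: cl_def)
  then show "e \<in> cl Y" using rk_mono[of Y "insert e Y"] by (simp add: cl_def subset_insertI)
qed

lemma subset_cl: "X \<subseteq> cl X"
  by (auto simp: cl_def insert_absorb)

lemma rk_Un_cl: "finite Y \<Longrightarrow> Y \<subseteq> cl X \<Longrightarrow> rk (X \<union> Y) = rk X"
proof (induction Y rule: finite_induct)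
  case (insert y Y)
  then have "y \<in> cl (X \<union> Y)" using cl_mono[of X "X \<union> Y"] by auto
  then show ?case using insert by (simp add: cl_def)
qed simp

lemma rk_le_cl: "finite Y \<Longrightarrow> Y \<subseteq> cl X \<Longrightarrow> rk Y \<le> rk X"
  using rk_Un_cl[of Y X] rk_mono[of Y "X \<union> Y"] by simp

lemma cl_trans: "e \<in> cl Y \<Longrightarrow> finite Y \<Longrightarrow> Y \<subseteq> cl X \<Longrightarrow> e \<in> cl X"
proof -
  assume a: "e \<in> cl Y" "finite Y" "Y \<subseteq> cl X"
  then have "e \<in> cl (X \<union> Y)" using cl_mono[of Y "X \<union> Y"] by auto
  then have "rk (insert e (X \<union> Y)) = rk X" using rk_Un_cl[OF a(2,3)] by (simp add: cl_def)
  moreover have "rk (insert e X) \<le> rk (insert e (X \<union> Y))" by (rule rk_mono) auto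
  ultimately show ?thesis using rk_mono[of X "insert e X"] by (simp add: cl_def subset_insertI)
qed

text \<open>Since \<open>C - {e}\<close> is independent and \<open>C\<close> is not,
  \<open>C - {e}\<close> is a basis of \<open>C\<close>.\<close>

lemma circuit_in_cl:
  assumes "circuit M C" "e \<in> C"
  shows "e \<in> cl (C - {e})"
proof -
  have C: "C - {e} \<in> indeps M" "C \<notin> indeps M" using assms by (auto simp: circuit_def)
  obtain I where I: "I \<in> indeps M" "C - {e} \<subseteq> I" "I \<subseteq> C" "card I = rk C"
    using indep_extend[OF C(1), of C] by auto
  have "I \<noteq> C" using I(1) C(2) by blast
  then have "I = C - {e}" using I(2,3) by auto
  then have "rk C = rk (C - {e})" using I rk_indep by simp
  then show ?thesis using assms(2) by (simp add: cl_def insert_absorb)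
qed

lemma rk_Un_le: "finite F \<Longrightarrow> rk (X \<union> F) \<le> rk X + card F"
proof (induction F rule: finite_induct)
  case (insert e F)
  then show ?case using rk_insert_le[of e "X \<union> F"] by simp
qed simp

lemma indep_if_rk: "finite X \<Longrightarrow> rk X = card X \<Longrightarrow> X \<in> indeps M"
  by (metis card_subset_eq rk_witness)

lemma matroid_rank_eq_rk: "matroid_rank M = rk (ground M)"
proof -
  have "{I \<in> indeps M. I \<subseteq> ground M} = indeps M" using indep_subset_ground by auto
  then show ?thesis by (simp add: matroid_rank_def rk_def)
qed

end

section \<open>Groups partitioned by normal subgroups\<close>

text \<open>By normality, the commutator of elements from different components lies in both
  components, so it is trivial. Two elements of one component are compared through an element
  outside it.\<close>

lemma (in group) normal_partition_comm:
  assumes normal: "\<And>L. L \<in> P \<Longrightarrow> L \<lhd> G"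
    and cover: "\<And>x. x \<in> carrier G \<Longrightarrow> \<exists>L \<in> P. x \<in> L"
    and disj: "\<And>L L'. L \<in> P \<Longrightarrow> L' \<in> P \<Longrightarrow> L \<noteq> L' \<Longrightarrow> L \<inter> L' = {\<one>}"
    and proper: "carrier G \<notin> P"
  shows "comm_group G"
proof (rule group_comm_groupI)
  have diff: "x \<otimes> y = y \<otimes> x" if L: "L \<in> P" "x \<in> L" and y: "y \<in> carrier G" "y \<notin> L" for L x y
  proof -
    obtain L' where L': "L' \<in> P" "y \<in> L'" using cover y by blast
    have n: "L \<lhd> G" "L' \<lhd> G" using normal L L' by auto
    then have s: "subgroup L G" "subgroup L' G" by (auto intro: normal_imp_subgroup)
    have x: "x \<in> carrier G" by (rule subgroup.mem_carrier[OF s(1) L(2)])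
    let ?c = "x \<otimes> y \<otimes> inv x \<otimes> inv y"
    have "y \<otimes> inv x \<otimes> inv y \<in> L"
      using normal.inv_op_closed2[OF n(1) y(1), of "inv x"] subgroup.m_inv_closed[OF s(1) L(2)] by simp
    then have "x \<otimes> (y \<otimes> inv x \<otimes> inv y) \<in> L" by (rule subgroup.m_closed[OF s(1) L(2)])
    then have "?c \<in> L" using x y by (simp add: m_assoc)
    moreover have "x \<otimes> y \<otimes> inv x \<in> L'"
      by (rule normal.inv_op_closed2[OF n(2) x L'(2)])
    then have "?c \<in> L'"
      using subgroup.m_closed[OF s(2)] subgroup.m_inv_closed[OF s(2) L'(2)] by blast
    moreover have "L \<noteq> L'" using L'(2) y(2) by blast
    ultimately have "?c = \<one>" using disj L(1) L'(1) by blast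
    then have "inv (inv y) = x \<otimes> y \<otimes> inv x" using x y by (intro inv_equality) auto
    then have "y = x \<otimes> y \<otimes> inv x" using y by simp
    then have "y \<otimes> x = x \<otimes> y \<otimes> inv x \<otimes> x" by simp
    then show ?thesis using x y by (simp add: m_assoc)
  qed
  fix x y assume xy: "x \<in> carrier G" "y \<in> carrier G"
  obtain L where L: "L \<in> P" "x \<in> L" using cover xy by blast
  show "x \<otimes> y = y \<otimes> x"
  proof (cases "y \<in> L")
    case True
    have s: "subgroup L G" using normal[OF L(1)] by (rule normal_imp_subgroup)
    have "L \<noteq> carrier G" using L(1) proper by auto
    \<comment> \<open>Both \<open>z\<close> and \<open>x \<otimes> z\<close> lie outside
      \<open>L\<close>, so \<open>y\<close> commutes with both; cancelling \<open>z\<close> leaves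
      that \<open>y\<close> commutes with \<open>x\<close>.\<close>
    then obtain z where z: "z \<in> carrier G" "z \<notin> L" using subgroup.subset[OF s] by blast
    have xz: "x \<otimes> z \<notin> L"
    proof
      assume "x \<otimes> z \<in> L"
      then have "inv x \<otimes> (x \<otimes> z) \<in> L"
        using subgroup.m_closed[OF s] subgroup.m_inv_closed[OF s L(2)] by blast
      then show False using xy z by (simp add: inv_solve_left m_assoc[symmetric])
    qed
    have "y \<otimes> (x \<otimes> z) = (x \<otimes> z) \<otimes> y" using diff[OF L(1) True _ xz] xy z by simp
    also have "\<dots> = x \<otimes> (y \<otimes> z)" using diff[OF L(1) True z] xy z by (simp add: m_assoc)
    finally have "y \<otimes> x \<otimes> z = x \<otimes> y \<otimes> z" using xy z by (simp add: m_assoc)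
    then show ?thesis using xy z by simp
  next
    case False
    then show ?thesis using diff[OF L xy(2)] by simp
  qed
qed

text \<open>An element of prime order \<open>p\<close> in one component forces exponent
  \<open>p\<close> on everything outside this component; an outside element then does the same for
  the component itself.\<close>

lemma (in comm_group) partition_exponent:
  assumes subgroup: "\<And>L. L \<in> P \<Longrightarrow> subgroup L G"
    and cover: "\<And>x. x \<in> carrier G \<Longrightarrow> \<exists>L \<in> P. x \<in> L"
    and disj: "\<And>L L'. L \<in> P \<Longrightarrow> L' \<in> P \<Longrightarrow> L \<noteq> L' \<Longrightarrow> L \<inter> L' = {\<one>}"
    and proper: "carrier G \<notin> P"
    and fin: "finite (carrier G)" and nontriv: "carrier G \<noteq> {\<one>}"
  obtains p :: nat where "prime p" "\<And>x. x \<in> carrier G \<Longrightarrow> x [^] p = \<one>"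
proof -
  have pow_closed: "x [^] (k::nat) \<in> L" if "L \<in> P" "x \<in> L" for L x k
    using subgroup[OF that(1)] that(2)
    by (induction k) (auto intro: subgroup.m_closed subgroup.one_closed)
  text \<open>If \<open>x\<close> has order \<open>p\<close> and \<open>y\<close> lies in another component, then \<open>(x \<otimes> y) [^] p = y [^] p\<close>
    lies in the components of both \<open>x \<otimes> y\<close> and \<open>y\<close>.\<close>
  have step: "y [^] p = \<one>"
    if L: "L \<in> P" "x \<in> L" "x \<noteq> \<one>" and p: "x [^] p = \<one>" and y: "y \<in> carrier G" "y \<notin> L"
    for L x y and p :: nat
  proof (rule ccontr)
    assume ne: "y [^] p \<noteq> \<one>"
    have x: "x \<in> carrier G" by (rule subgroup.mem_carrier[OF subgroup[OF L(1)] L(2)])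
    obtain A where A: "A \<in> P" "y \<in> A" using cover y by blast
    obtain B where B: "B \<in> P" "x \<otimes> y \<in> B" using cover x y by blast
    have "(x \<otimes> y) [^] p = y [^] p" using x y p by (simp add: nat_pow_distrib)
    then have "y [^] p \<in> A \<inter> B" using pow_closed[OF A] pow_closed[OF B, of p] by simp
    then have "A = B" using disj[OF A(1) B(1)] ne by blast
    then have "x \<otimes> y \<otimes> inv y \<in> A"
      using subgroup.m_closed[OF subgroup[OF A(1)]] subgroup.m_inv_closed[OF subgroup[OF A(1)] A(2)] B(2)
      by blast
    then have "x \<in> A" using x y by (simp add: m_assoc)
    then have "A = L" using disj[OF A(1) L(1)] L(2,3) by blast
    then show False using A(2) y(2) by simp
  qed
  obtain g where g: "g \<in> carrier G" "g \<noteq> \<one>" using nontriv one_closed by blast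
  then have "ord g \<noteq> 1" using ord_eq_1 by blast
  then obtain p where p: "prime p" "p dvd ord g" using prime_factor_nat by blast
  then obtain k where k: "ord g = p * k" by blast
  \<comment> \<open>Here \<open>k\<close> is \<open>ord g\<close> divided by \<open>p\<close>, so
    \<open>x\<close> has order \<open>p\<close>: the exponent \<open>p * k\<close> kills
    \<open>g\<close>, and \<open>k\<close> is too small to do so.\<close>
  define x where "x = g [^] k"
  have og: "ord g > 0" using ord_ge_1[OF fin g(1)] by simp
  have x: "x \<in> carrier G" "x [^] p = \<one>"
    using g pow_ord_eq_1[OF g(1)] by (simp_all add: x_def nat_pow_pow k mult.commute)
  have "\<not> ord g dvd k"
  proof
    assume "ord g dvd k"
    then have "p * k \<le> k" using k og by (auto intro: dvd_imp_le)
    then show False using og k prime_gt_1_nat[OF p(1)] by simp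
  qed
  then have x1: "x \<noteq> \<one>" unfolding x_def using pow_eq_id[OF g(1)] by simp
  obtain L where L: "L \<in> P" "x \<in> L" using cover x by blast
  have "L \<noteq> carrier G" using L(1) proper by auto
  then obtain z where z: "z \<in> carrier G" "z \<notin> L"
    using subgroup.subset[OF subgroup[OF L(1)]] by blast
  obtain A where A: "A \<in> P" "z \<in> A" using cover z by blast
  have zp: "z [^] p = \<one>" by (rule step[OF L x1 x(2) z])
  have z1: "z \<noteq> \<one>" using z(2) subgroup.one_closed[OF subgroup[OF L(1)]] by auto
  have "y [^] p = \<one>" if y: "y \<in> carrier G" for y
  proof (cases "y = \<one> \<or> y \<notin> L")
    case True
    then show ?thesis using step[OF L x1 x(2) y] by auto
  next
    case False
    \<comment> \<open>Now \<open>z\<close> from the other component \<open>A\<close> takes the role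
      of \<open>x\<close>.\<close>
    have "y \<notin> A"
    proof
      assume "y \<in> A"
      then have "A = L" using False disj[OF A(1) L(1)] by blast
      then show False using A z by simp
    qed
    then show ?thesis by (rule step[OF A z1 zp y])
  qed
  then show ?thesis using that p(1) by blast
qed

text \<open>This is the existence of a basis over the field with \<open>p\<close> elements, in
  multiplicative notation: a longest independent family spans.\<close>

lemma (in comm_group) elementary_abelian_iso:
  fixes p :: nat
  assumes fin: "finite (carrier G)" and p: "prime p"
    and exp: "\<And>x. x \<in> carrier G \<Longrightarrow> x [^] p = \<one>"
  obtains j :: nat where "G \<cong> sum_group {..<j} (\<lambda>_. integer_mod_group p)"
proof -
  let ?Z = "integer_mod_group p"
  let ?S = "\<lambda>j::nat. sum_group {..<j} (\<lambda>_. ?Z)"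
  \<comment> \<open>\<open>f g j\<close> sends a coordinate vector \<open>x\<close> to the linear
    combination of the first \<open>j\<close> members of the family \<open>g\<close> with
    coefficients \<open>x\<close>.\<close>
  define f where "f = (\<lambda>g j x. gfinprod G (\<lambda>i. g i [^] (x i :: int)) {..<j::nat})"
  have p1: "p > 1" using p prime_gt_1_nat by blast
  have expz: "x [^] (k mod int p) = x [^] k" if "x \<in> carrier G" for x and k :: int
  proof -
    have "x [^] int p = \<one>" using exp[OF that] by (simp add: int_pow_int)
    then have "x [^] (int p * (k div int p)) = \<one>" using that by (simp flip: int_pow_pow)
    moreover have "x [^] k = x [^] (int p * (k div int p) + k mod int p)" by simp
    ultimately show ?thesis using that by (simp only: int_pow_mult) simp
  qed
  have carS: "carrier (?S j) = (\<Pi>\<^sub>E i\<in>{..<j}. {0..<int p})" for j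
    using p1 by (subst carrier_sum_group) (auto simp: carrier_integer_mod_group)
  have grpS: "group (?S j)" for j by simp
  have hom: "f g j \<in> hom (?S j) G" if "\<forall>i. g i \<in> carrier G" for g j
    unfolding f_def
  proof (rule hom_group_sum)
    show "(\<lambda>k. g i [^] k) \<in> hom ?Z G" for i
      using that by (intro homI) (auto simp: expz int_pow_mult)
  qed simp
  have ghom: "group_hom (?S j) G (f g j)" if "\<forall>i. g i \<in> carrier G" for g j
    using hom[OF that] grpS is_group by (simp add: group_hom_def group_hom_axioms_def)
  \<comment> \<open>\<open>Q j\<close> says that some family of length \<open>j\<close> is linearly
    independent.\<close>
  define Q where "Q j \<longleftrightarrow> (\<exists>g. (\<forall>i. g i \<in> carrier G) \<and> inj_on (f g j) (carrier (?S j)))" for j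
  have "carrier (?S 0) = {\<lambda>_. undefined}" using carS[of 0] by simp
  then have "Q 0" unfolding Q_def by (intro exI[of _ "\<lambda>_. \<one>"]) simp
  \<comment> \<open>The combinations of an independent family are \<open>p ^ j > j\<close> distinct
    elements. Its length is therefore bounded, and a greatest \<open>j\<close> exists.\<close>
  have bound: "j \<le> card (carrier G)" if "Q j" for j
  proof -
    obtain g where g: "\<forall>i. g i \<in> carrier G" "inj_on (f g j) (carrier (?S j))"
      using \<open>Q j\<close> unfolding Q_def by blast
    have "f g j ` carrier (?S j) \<subseteq> carrier G" using hom[OF g(1)] by (auto simp: hom_def Pi_iff)
    then have "card (carrier (?S j)) \<le> card (carrier G)" using card_inj_on_le[OF g(2) _ fin] by blast
    moreover have "card (carrier (?S j)) = p ^ j" by (simp add: carS card_PiE)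
    moreover have "j < p ^ j" using p1 power_gt_expt[of p j] by simp
    ultimately show ?thesis by simp
  qed
  define j where "j = (GREATEST j. Q j)"
  have Qj: "Q j" unfolding j_def using \<open>Q 0\<close> bound by (rule GreatestI_nat)
  have max: "\<not> Q (Suc j)"
  proof
    assume "Q (Suc j)"
    then have "Suc j \<le> j" unfolding j_def using bound by (rule Greatest_le_nat)
    then show False by simp
  qed
  obtain g where g: "\<forall>i. g i \<in> carrier G" "inj_on (f g j) (carrier (?S j))"
    using Qj unfolding Q_def by blast
  have F: "group_hom (?S j) G (f g j)" by (rule ghom[OF g(1)])
  have "h \<in> f g j ` carrier (?S j)" if h: "h \<in> carrier G" for h
  proof (rule ccontr)
    assume nh: "h \<notin> f g j ` carrier (?S j)"
    \<comment> \<open>An \<open>h\<close> outside the span can be appended to the family, against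
      the choice of \<open>j\<close>.\<close>
    define g' where "g' = g(j := h)"
    have g': "\<forall>i. g' i \<in> carrier G" using g(1) h by (simp add: g'_def)
    have F': "group_hom (?S (Suc j)) G (f g' (Suc j))" by (rule ghom[OF g'])
    have "x = \<one>\<^bsub>?S (Suc j)\<^esub>" if x: "x \<in> carrier (?S (Suc j))" and x1: "f g' (Suc j) x = \<one>" for x
    proof -
      have xm: "x i \<in> {0..<int p}" if "i < Suc j" for i
        using x that unfolding carS by (intro PiE_mem[of x "{..<Suc j}"]) auto
      define y where "y = restrict x {..<j}"
      have y: "y \<in> carrier (?S j)" using xm unfolding carS y_def by (subst restrict_PiE_iff) auto
      have *: "f g' j x = f g j y"
        unfolding f_def using g(1) by (intro gfinprod_cong) (auto simp: g'_def y_def simp_implies_def)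
      have xj: "0 \<le> x j" "x j < int p" using xm[of j] by auto
      have fy: "f g j y \<in> f g j ` carrier (?S j)" using y by blast
      have "f g' (Suc j) x = g' j [^] x j \<otimes> f g' j x"
        unfolding f_def lessThan_Suc using g' by (subst gfinprod_insert) auto
      then have "h [^] x j \<otimes> f g' j x = \<one>" using x1 by (simp add: g'_def)
      then have eq: "h [^] x j \<otimes> f g j y = \<one>" by (simp only: *)
      \<comment> \<open>A nonzero coefficient of \<open>h\<close> is invertible modulo
        \<open>p\<close>, so \<open>h\<close> would be a power of an element of the span.\<close>
      have "x j = 0"
      proof (rule ccontr)
        assume "x j \<noteq> 0"
        then have "\<not> int p dvd x j" using xj zdvd_not_zless[of "x j" "int p"] by simp
        then have "coprime (int p) (x j)" using p by (simp add: prime_imp_coprime)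
        then obtain k where "[x j * k = 1] (mod int p)"
          using cong_solve_coprime_int[of "x j" "int p"] by (auto simp: coprime_commute)
        then have "x j * k mod int p = 1" using p1 by (simp add: cong_def)
        then have "h [^] (x j * k) = h" using expz[OF h, of "x j * k"] h by simp
        then have "(h [^] x j) [^] k = h" using h by (simp add: int_pow_pow)
        moreover have "h [^] x j = inv (f g j y)" using eq h group_hom.hom_closed[OF F y]
          by (intro inv_equality[symmetric]) simp_all
        then have "h [^] x j \<in> f g j ` carrier (?S j)"
          using subgroup.m_inv_closed[OF group_hom.img_is_subgroup[OF F] fy] by simp
        then have "(h [^] x j) [^] k \<in> f g j ` carrier (?S j)"
          by (rule subgroup_int_pow_closed[OF group_hom.img_is_subgroup[OF F]])
        ultimately show False using nh by simp
      qed
      \<comment> \<open>With the coefficient of \<open>h\<close> gone, independence of the old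
        family kills the others.\<close>
      then have "f g j y = f g j \<one>\<^bsub>?S j\<^esub>" using eq h group_hom.hom_closed[OF F y] group_hom.hom_one[OF F] by simp
      then have "y = \<one>\<^bsub>?S j\<^esub>" by (rule inj_onD[OF g(2) _ y]) (rule group.is_monoid[OF grpS, THEN monoid.one_closed])
      then have y0: "y i = 0" if "i < j" for i using that by simp
      have "x i = (if i < Suc j then 0 else undefined)" for i
      proof -
        consider "i < j" | "i = j" | "i \<notin> {..<Suc j}" by fastforce
        then show ?thesis
        proof cases
          case 1
          then show ?thesis using y0[of i] by (simp add: y_def)
        next
          case 3
          then show ?thesis using PiE_arb[OF x[unfolded carS] 3] by simp
        qed (simp add: \<open>x j = 0\<close>)
      qed
      then show ?thesis by (auto simp: fun_eq_iff)
    qed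
    then have "kernel (?S (Suc j)) G (f g' (Suc j)) \<subseteq> {\<one>\<^bsub>?S (Suc j)\<^esub>}"
      unfolding kernel_def by (intro subsetI) (simp only: mem_Collect_eq singleton_iff)
    moreover have "\<one>\<^bsub>?S (Suc j)\<^esub> \<in> kernel (?S (Suc j)) G (f g' (Suc j))"
      by (rule subgroup.one_closed[OF group_hom.subgroup_kernel[OF F']])
    ultimately have "inj_on (f g' (Suc j)) (carrier (?S (Suc j)))"
      by (intro group_hom.trivial_ker_imp_inj[OF F'] equalityI) simp_all
    then show False using max g' unfolding Q_def by blast
  qed
  then have "bij_betw (f g j) (carrier (?S j)) (carrier G)"
    using g(2) group_hom.hom_closed[OF F] by (auto simp: bij_betw_def)
  then have "f g j \<in> iso (?S j) G" using hom[OF g(1)] by (simp add: iso_def)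
  then have "?S j \<cong> G" by (auto simp: is_iso_def)
  then have "G \<cong> ?S j" using group.iso_sym[OF grpS] by blast
  then show ?thesis by (rule that)
qed

lemma (in group) normal_partition_elementary_abelian:
  assumes normal: "\<And>L. L \<in> P \<Longrightarrow> L \<lhd> G"
    and cover: "\<And>x. x \<in> carrier G \<Longrightarrow> \<exists>L \<in> P. x \<in> L"
    and disj: "\<And>L L'. L \<in> P \<Longrightarrow> L' \<in> P \<Longrightarrow> L \<noteq> L' \<Longrightarrow> L \<inter> L' = {\<one>}"
    and proper: "carrier G \<notin> P"
    and fin: "finite (carrier G)" and nontriv: "carrier G \<noteq> {\<one>}"
  shows "\<exists>(p::nat) (j::nat). prime p \<and> j \<ge> 2 \<and> G \<cong> sum_group {..<j} (\<lambda>_. integer_mod_group p)"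
proof -
  interpret comm_group G by (rule normal_partition_comm[OF normal cover disj proper])
  have subgroup: "subgroup L G" if "L \<in> P" for L using normal[OF that] by (rule normal_imp_subgroup)
  obtain p :: nat where p: "prime p" "\<And>x. x \<in> carrier G \<Longrightarrow> x [^] p = \<one>"
    using partition_exponent[OF subgroup cover disj proper fin nontriv] by metis
  obtain j :: nat where j: "G \<cong> sum_group {..<j} (\<lambda>_. integer_mod_group p)" (is "_ \<cong> ?S")
    using elementary_abelian_iso[OF fin p] by metis
  obtain h where "h \<in> iso G ?S" using j by (auto simp: is_iso_def)
  then have "card (carrier G) = card (carrier ?S)" by (auto simp: iso_def intro: bij_betw_same_card)
  also have "carrier ?S = (\<Pi>\<^sub>E i\<in>{..<j}. {0..<int p})"
    using prime_gt_0_nat[OF p(1)] by (subst carrier_sum_group) (auto simp: carrier_integer_mod_group)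
  finally have card: "card (carrier G) = p ^ j" by (simp add: card_PiE)
  obtain g where g: "g \<in> carrier G" "g \<noteq> \<one>" using nontriv one_closed by blast
  obtain L where L: "L \<in> P" "g \<in> L" using cover g(1) by blast
  \<comment> \<open>The component \<open>L\<close> of \<open>g\<close> has order strictly between
    \<open>1\<close> and \<open>p ^ j\<close>, and by Lagrange this order divides
    \<open>p ^ j\<close>. Hence \<open>j\<close> is neither \<open>0\<close> nor
    \<open>1\<close>.\<close>
  have LG: "L \<subset> carrier G" using subgroup.subset[OF subgroup[OF L(1)]] L(1) proper by blast
  then have less: "card L < p ^ j" using psubset_card_mono[OF fin] card by simp
  have "card {\<one>, g} \<le> card L"
    using L subgroup.one_closed[OF subgroup[OF L(1)]] finite_subset[OF _ fin] LG
    by (intro card_mono) auto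
  then have gt: "card L > 1" using g(2) by simp
  have dvd: "card L dvd p ^ j"
    using lagrange[OF subgroup[OF L(1)]] card by (metis dvd_triv_right order_def)
  have "j \<noteq> 0" using less gt by (intro notI) simp
  moreover have "j \<noteq> 1" using less gt dvd p(1) by (auto simp: prime_nat_iff)
  ultimately have "j \<ge> 2" by simp
  then show ?thesis using p(1) j by blast
qed

section \<open>The matroid on the gain group\<close>

text \<open>The interface between the lift and the group argument. \<open>edge i j a\<close> is the
  edge joining \<open>i\<close> and \<open>j\<close> whose gain is \<open>a\<close> when read from
  \<open>i\<close> to \<open>j\<close>. \<open>bridge\<close> expresses the lift property through
  cuts, \<open>triangle\<close> comes from balanced cycles and \<open>parallel\<close> from
  unbalanced ones.\<close>

locale gain_lift = group \<Gamma> + matroid M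
  for \<Gamma> :: "('a, 'b) monoid_scheme" (structure) and M :: "'e pre_matroid" +
  fixes n :: nat and edge :: "nat \<Rightarrow> nat \<Rightarrow> 'a \<Rightarrow> 'e"
  assumes four_le: "n \<ge> 4"
    and finite_carrier: "finite (carrier \<Gamma>)"
    and reverse: "a \<in> carrier \<Gamma> \<Longrightarrow> i \<noteq> j \<Longrightarrow> edge j i (inv a) = edge i j a"
    and triangle: "distinct [i, j, k] \<Longrightarrow> {i, j, k} \<subseteq> {1..n} \<Longrightarrow> a \<in> carrier \<Gamma> \<Longrightarrow> b \<in> carrier \<Gamma> \<Longrightarrow>
      edge i k (a \<otimes> b) \<in> cl {edge i j a, edge j k b}"
    and bridge: "i \<in> S \<Longrightarrow> j \<notin> S \<Longrightarrow> {i, j} \<subseteq> {1..n} \<Longrightarrow> a \<in> carrier \<Gamma> \<Longrightarrow>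
      X \<subseteq> {edge k l b |k l b. k \<noteq> l \<and> {k, l} \<subseteq> {1..n} \<and> b \<in> carrier \<Gamma> \<and> (k \<in> S \<longleftrightarrow> l \<in> S)} \<Longrightarrow>
      rk (insert (edge i j a) X) = Suc (rk X)"
    and parallel: "i \<noteq> j \<Longrightarrow> {i, j} \<subseteq> {1..n} \<Longrightarrow> a \<in> carrier \<Gamma> \<Longrightarrow> b \<in> carrier \<Gamma> \<Longrightarrow> a \<noteq> b \<Longrightarrow>
      rk {edge i j a, edge i j b} = 2"
begin

section \<open>Cuts, triangles and ranks of label sets\<close>

definition uncut :: "nat set \<Rightarrow> 'e set" where
  "uncut S = {edge k l b |k l b. k \<noteq> l \<and> {k, l} \<subseteq> {1..n} \<and> b \<in> carrier \<Gamma> \<and> (k \<in> S \<longleftrightarrow> l \<in> S)}"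

lemma uncutI: "k \<noteq> l \<Longrightarrow> {k, l} \<subseteq> {1..n} \<Longrightarrow> b \<in> carrier \<Gamma> \<Longrightarrow> k \<in> S \<longleftrightarrow> l \<in> S \<Longrightarrow> edge k l b \<in> uncut S"
  unfolding uncut_def by blast

lemma rk_bridge:
  "i \<in> S \<Longrightarrow> j \<notin> S \<Longrightarrow> {i, j} \<subseteq> {1..n} \<Longrightarrow> a \<in> carrier \<Gamma> \<Longrightarrow> X \<subseteq> uncut S \<Longrightarrow>
    rk (insert (edge i j a) X) = Suc (rk X)"
  unfolding uncut_def by (rule bridge)

lemma cl_inv: "edge i j a \<in> cl X \<Longrightarrow> a \<in> carrier \<Gamma> \<Longrightarrow> i \<noteq> j \<Longrightarrow> edge j i (inv a) \<in> cl X"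
  by (simp add: reverse)

lemma cl_mult:
  assumes "edge i j a \<in> cl X" "edge j k b \<in> cl X" "distinct [i, j, k]" "{i, j, k} \<subseteq> {1..n}"
    "a \<in> carrier \<Gamma>" "b \<in> carrier \<Gamma>"
  shows "edge i k (a \<otimes> b) \<in> cl X"
  by (rule cl_trans[OF triangle[OF assms(3-6)]]) (use assms(1,2) in auto)

lemma finite_image_edge: "A \<subseteq> carrier \<Gamma> \<Longrightarrow> finite (edge i j ` A)"
  using finite_carrier finite_subset by auto

text \<open>With \<open>edge j k b\<close> added, triangles turn the edge of gain \<open>a\<close>
  from \<open>i\<close> to \<open>j\<close> into the edge of gain \<open>a \<otimes> b\<close> from
  \<open>i\<close> to \<open>k\<close> and back, so each set lies in the closure of the other. The
  added edge is a bridge over either label set and raises both ranks by one.\<close>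

lemma rk_edge_image_mult:
  assumes d: "distinct [i, j, k]" "{i, j, k} \<subseteq> {1..n}" and A: "A \<subseteq> carrier \<Gamma>" and b: "b \<in> carrier \<Gamma>"
  shows "rk (edge i k ` (\<lambda>a. a \<otimes> b) ` A) = rk (edge i j ` A)"
proof -
  let ?A = "(\<lambda>a. a \<otimes> b) ` A"
  let ?X = "insert (edge j k b) (edge i j ` A)" and ?Y = "insert (edge j k b) (edge i k ` ?A)"
  have A': "?A \<subseteq> carrier \<Gamma>" using A b by auto
  have X: "edge j k b \<in> cl ?X" "a \<in> A \<Longrightarrow> edge i j a \<in> cl ?X" for a
    using subset_cl[of ?X] by auto
  have Y: "edge j k b \<in> cl ?Y" "a \<in> ?A \<Longrightarrow> edge i k a \<in> cl ?Y" for a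
    using subset_cl[of ?Y] by auto
  have "edge i k (a \<otimes> b) \<in> cl ?X" if "a \<in> A" for a
    using cl_mult[OF X(2)[OF that] X(1) d] A b that by auto
  then have "?Y \<subseteq> cl ?X" using X(1) by auto
  moreover have "edge i j a \<in> cl ?Y" if "a \<in> A" for a
  proof -
    have a: "a \<in> carrier \<Gamma>" using that A by auto
    have "edge k j (inv b) \<in> cl ?Y" using cl_inv[OF Y(1) b] d by auto
    then have "edge i j (a \<otimes> b \<otimes> inv b) \<in> cl ?Y"
      using cl_mult[OF Y(2)] that d a b by auto
    then show ?thesis using a b by (simp add: m_assoc)
  qed
  then have "?X \<subseteq> cl ?Y" using Y(1) by auto
  ultimately have "rk ?X = rk ?Y"
    using rk_le_cl finite_image_edge[OF A] finite_image_edge[OF A'] by (metis finite_insert order_antisym)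
  moreover have "rk ?X = Suc (rk (edge i j ` A))"
    by (rule rk_bridge[of _ "{i, j}"]) (use d A b in \<open>auto intro!: uncutI\<close>)
  \<comment> \<open>The cut is a complement because \<open>rk_bridge\<close> wants the first
    endpoint \<open>j\<close> inside \<open>S\<close>.\<close>
  moreover have "rk ?Y = Suc (rk (edge i k ` ?A))"
    by (rule rk_bridge[of _ "- {i, k}"]) (use d A' b in \<open>auto intro!: uncutI\<close>)
  ultimately show ?thesis by simp
qed

text \<open>The pair \<open>1 2\<close> is a reference choice: \<open>rk_edge_image\<close> gives
  the same value on every ordered pair of distinct vertices.\<close>

definition R :: "'a set \<Rightarrow> nat" where
  "R A = rk (edge 1 2 ` A)"

lemma edge_inv_image: "A \<subseteq> carrier \<Gamma> \<Longrightarrow> i \<noteq> j \<Longrightarrow> edge j i ` m_inv \<Gamma> ` A = edge i j ` A"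
  unfolding image_image by (rule image_cong) (auto simp: reverse)

lemma rk_edge_image_change_head:
  assumes "distinct [i, j, k]" "{i, j, k} \<subseteq> {1..n}" "A \<subseteq> carrier \<Gamma>"
  shows "rk (edge i k ` A) = rk (edge i j ` A)"
proof -
  have "(\<lambda>a. a \<otimes> \<one>) ` A = A" using assms(3) by (force simp: subset_iff image_iff)
  then show ?thesis using rk_edge_image_mult[OF assms one_closed] by simp
qed

lemma rk_edge_image_change_tail:
  assumes "distinct [i, j, k]" "{i, j, k} \<subseteq> {1..n}" "A \<subseteq> carrier \<Gamma>"
  shows "rk (edge k j ` A) = rk (edge i j ` A)"
proof -
  have "rk (edge j k ` m_inv \<Gamma> ` A) = rk (edge j i ` m_inv \<Gamma> ` A)"
    by (rule rk_edge_image_change_head) (use assms in auto)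
  then show ?thesis using assms by (auto simp: edge_inv_image)
qed

text \<open>Any ordered pair is reached from \<open>1 2\<close> by moving one endpoint at a
  time.\<close>

lemma rk_edge_image:
  assumes ij: "i \<noteq> j" "{i, j} \<subseteq> {1..n}" and A: "A \<subseteq> carrier \<Gamma>"
  shows "rk (edge i j ` A) = R A"
proof -
  have from1: "rk (edge 1 j ` A) = R A" if "j \<noteq> 1" "j \<in> {1..n}" for j
    using rk_edge_image_change_head[of 1 2 j A] that A four_le unfolding R_def by (cases "j = 2") auto
  have to2: "rk (edge i 2 ` A) = R A" if "i \<noteq> 2" "i \<in> {1..n}" for i
    using rk_edge_image_change_tail[of 1 2 i A] that A four_le unfolding R_def by (cases "i = 1") auto
  have not1: "rk (edge i j ` A) = R A" if "i \<noteq> j" "{i, j} \<subseteq> {1..n}" "j \<noteq> 1" for i j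
    using rk_edge_image_change_tail[of 1 j i A] that A four_le from1[of j] by (cases "i = 1") auto
  show ?thesis
  proof (cases "j = 1")
    case True
    \<comment> \<open>Head \<open>1\<close> is reached through an auxiliary head \<open>k\<close>
      distinct from \<open>1\<close> and \<open>i\<close>.\<close>
    obtain k where "k \<in> {2, 3}" "k \<noteq> i" by (metis insertCI numeral_eq_iff semiring_norm(89))
    then show ?thesis
      using rk_edge_image_change_head[of i k j A] not1[of i k] ij A four_le True by auto
  qed (use not1 ij in simp)
qed

lemma R_mult: "A \<subseteq> carrier \<Gamma> \<Longrightarrow> b \<in> carrier \<Gamma> \<Longrightarrow> R ((\<lambda>a. a \<otimes> b) ` A) = R A"
  using rk_edge_image_mult[of 1 2 3 A b] rk_edge_image[of 1 3 "(\<lambda>a. a \<otimes> b) ` A"] four_le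
  by (force simp: R_def)

text \<open>With an edge of gain \<open>\<one>\<close> on \<open>23\<close>, the labels in
  \<open>A\<close> pass from \<open>12\<close> to \<open>13\<close>, and the way
  \<open>2 1 3\<close> then puts \<open>inv a \<otimes> b\<close> on \<open>23\<close>. One bridge
  is peeled off on each side; \<open>c\<close> supplies the one that joins vertex \<open>1\<close>
  to the quotients on \<open>23\<close>.\<close>

lemma R_quotients:
  assumes A: "A \<subseteq> carrier \<Gamma>" "c \<in> A"
  shows "R ((\<lambda>(a, b). inv a \<otimes> b) ` (A \<times> A)) \<le> R A"
proof -
  let ?Q = "(\<lambda>(a, b). inv a \<otimes> b) ` (A \<times> A)"
  let ?X = "insert (edge 2 3 \<one>) (edge 1 2 ` A)" and ?Y = "insert (edge 1 2 c) (edge 2 3 ` ?Q)"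
  have Q: "?Q \<subseteq> carrier \<Gamma>" using A by auto
  have X: "edge 2 3 \<one> \<in> cl ?X" "a \<in> A \<Longrightarrow> edge 1 2 a \<in> cl ?X" for a
    using subset_cl[of ?X] by auto
  have "edge 2 3 (inv a \<otimes> b) \<in> cl ?X" if "a \<in> A" "b \<in> A" for a b
  proof -
    have ab: "a \<in> carrier \<Gamma>" "b \<in> carrier \<Gamma>" using that A by auto
    have "edge 2 1 (inv a) \<in> cl ?X" using cl_inv[OF X(2)[OF that(1)] ab(1)] by simp
    moreover have "edge 1 3 b \<in> cl ?X" using cl_mult[OF X(2)[OF that(2)] X(1)] ab four_le by simp
    ultimately show ?thesis using cl_mult[of 2 1 "inv a" ?X 3 b] ab four_le by simp
  qed
  then have "?Y \<subseteq> cl ?X" using X(2) A(2) by auto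
  then have "rk ?Y \<le> rk ?X" using rk_le_cl finite_image_edge[OF Q] by (metis finite_insert)
  moreover have "rk ?X = Suc (R A)"
    unfolding R_def by (rule rk_bridge[of _ "{1, 2}"]) (use A four_le in \<open>auto intro!: uncutI\<close>)
  moreover have "rk ?Y = Suc (rk (edge 2 3 ` ?Q))"
    by (rule rk_bridge[of _ "{1}"]) (use A Q four_le in \<open>auto intro!: uncutI\<close>)
  moreover have "rk (edge 2 3 ` ?Q) = R ?Q" using rk_edge_image[OF _ _ Q] four_le by simp
  ultimately show ?thesis by simp
qed

text \<open>Copies of \<open>A\<close> on the disjoint pairs \<open>12\<close> and \<open>34\<close> together have rank \<open>R A + 1\<close>, as seen by
  joining them by the edge \<open>23\<close> of gain \<open>\<one>\<close>. Joining them by the edge of gain \<open>g\<close> instead puts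
  both \<open>g A\<close> and \<open>A g\<close> on \<open>23\<close>.\<close>

lemma R_left_right:
  assumes A: "A \<subseteq> carrier \<Gamma>" "\<one> \<in> A" and g: "g \<in> carrier \<Gamma>"
  shows "R ((\<lambda>a. g \<otimes> a) ` A \<union> (\<lambda>a. a \<otimes> g) ` A) \<le> R A"
proof -
  let ?B = "(\<lambda>a. g \<otimes> a) ` A \<union> (\<lambda>a. a \<otimes> g) ` A"
  let ?Y = "edge 1 2 ` A \<union> edge 3 4 ` A"
  let ?Z = "insert (edge 3 4 \<one>) (insert (edge 2 3 \<one>) (edge 1 2 ` A))"
  let ?Yg = "insert (edge 2 3 g) ?Y"
  let ?W = "insert (edge 1 2 \<one>) (insert (edge 3 4 \<one>) (edge 2 3 ` ?B))"
  have V: "{1, 2, 3, 4} \<subseteq> {1..n}" using four_le by auto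
  have B: "?B \<subseteq> carrier \<Gamma>" using A g by auto
  have fin: "finite ?Y" "finite ?W" using finite_image_edge[OF A(1)] finite_image_edge[OF B] by auto
  have Z: "edge 3 4 \<one> \<in> cl ?Z" "edge 2 3 \<one> \<in> cl ?Z" "a \<in> A \<Longrightarrow> edge 1 2 a \<in> cl ?Z" for a
    using subset_cl[of ?Z] by auto
  have Z13: "edge 1 3 a \<in> cl ?Z" if "a \<in> A" for a
    using cl_mult[OF Z(3)[OF that] Z(2)] A that V by auto
  have "edge 3 4 a \<in> cl ?Z" if "a \<in> A" for a
  proof -
    have a: "a \<in> carrier \<Gamma>" using that A by auto
    have "edge 1 4 a \<in> cl ?Z" using cl_mult[OF Z13[OF that] Z(1)] a V by simp
    moreover have "edge 3 1 \<one> \<in> cl ?Z" using cl_inv[OF Z13[OF A(2)]] by simp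
    ultimately show ?thesis using cl_mult[of 3 1 \<one> ?Z 4 a] a V by simp
  qed
  then have "insert (edge 2 3 \<one>) ?Y \<subseteq> cl ?Z" using Z by auto
  then have "rk (insert (edge 2 3 \<one>) ?Y) \<le> rk ?Z" using rk_le_cl fin by simp
  \<comment> \<open>The rank does not depend on the gain \<open>h\<close> of the joining edge, so
    the bound found for \<open>\<one>\<close> carries over to \<open>g\<close>.\<close>
  moreover have "rk (insert (edge 2 3 h) ?Y) = Suc (rk ?Y)" if "h \<in> carrier \<Gamma>" for h
    by (rule rk_bridge[of _ "{1, 2}"]) (use A V that in \<open>auto intro!: uncutI\<close>)
  moreover have "rk (insert (edge 2 3 \<one>) (edge 1 2 ` A)) = Suc (R A)"
    unfolding R_def by (rule rk_bridge[of _ "{1, 2}"]) (use A V in \<open>auto intro!: uncutI\<close>)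
  moreover have "rk ?Z = Suc (rk (insert (edge 2 3 \<one>) (edge 1 2 ` A)))"
    by (rule rk_bridge[of _ "{1, 2, 3}"]) (use A V in \<open>auto intro!: uncutI\<close>)
  ultimately have Yg: "rk ?Yg \<le> Suc (Suc (R A))" using g by simp
  have Y: "edge 2 3 g \<in> cl ?Yg" "a \<in> A \<Longrightarrow> edge 1 2 a \<in> cl ?Yg" "a \<in> A \<Longrightarrow> edge 3 4 a \<in> cl ?Yg" for a
    using subset_cl[of ?Yg] by auto
  \<comment> \<open>The gain \<open>a \<otimes> g\<close> is read along \<open>1 2 3\<close> and
    moved to \<open>23\<close> by the edge of gain \<open>\<one>\<close> on \<open>12\<close>,
    present since \<open>\<one> \<in> A\<close>. Likewise \<open>g \<otimes> a\<close> is read along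
    \<open>2 3 4\<close> and moved by the edge of gain \<open>\<one>\<close> on
    \<open>34\<close>.\<close>
  have "edge 2 3 (a \<otimes> g) \<in> cl ?Yg" if "a \<in> A" for a
  proof -
    have a: "a \<in> carrier \<Gamma>" using that A by auto
    have "edge 1 3 (a \<otimes> g) \<in> cl ?Yg" using cl_mult[OF Y(2)[OF that] Y(1)] a g V by simp
    moreover have "edge 2 1 \<one> \<in> cl ?Yg" using cl_inv[OF Y(2)[OF A(2)]] by simp
    ultimately show ?thesis using cl_mult[of 2 1 \<one> ?Yg 3 "a \<otimes> g"] a g V by simp
  qed
  moreover have "edge 2 3 (g \<otimes> a) \<in> cl ?Yg" if "a \<in> A" for a
  proof -
    have a: "a \<in> carrier \<Gamma>" using that A by auto
    have "edge 2 4 (g \<otimes> a) \<in> cl ?Yg" using cl_mult[OF Y(1) Y(3)[OF that]] a g V by simp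
    moreover have "edge 4 3 \<one> \<in> cl ?Yg" using cl_inv[OF Y(3)[OF A(2)]] by simp
    ultimately show ?thesis using cl_mult[of 2 4 "g \<otimes> a" ?Yg 3 \<one>] a g V by simp
  qed
  ultimately have "?W \<subseteq> cl ?Yg" using Y A(2) by auto
  then have "rk ?W \<le> rk ?Yg" using rk_le_cl fin by blast
  \<comment> \<open>Peeling off vertex \<open>1\<close> and then vertex \<open>4\<close> costs two,
    matching the bound \<open>R A + 2\<close> for \<open>?Yg\<close>.\<close>
  moreover have "rk ?W = Suc (rk (insert (edge 3 4 \<one>) (edge 2 3 ` ?B)))"
    by (rule rk_bridge[of _ "{1}"]) (use B V in \<open>auto intro!: uncutI\<close>)
  moreover have "rk (insert (edge 3 4 \<one>) (edge 2 3 ` ?B)) = Suc (rk (edge 2 3 ` ?B))"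
    by (rule rk_bridge[of _ "{2, 3}"]) (use B V in \<open>auto intro!: uncutI\<close>)
  moreover have "rk (edge 2 3 ` ?B) = R ?B" using rk_edge_image[OF _ _ B] V by simp
  ultimately show ?thesis using Yg by simp
qed

section \<open>Lines through the identity\<close>

definition line :: "'a \<Rightarrow> 'a set" where
  "line x = {y \<in> carrier \<Gamma>. edge 1 2 y \<in> cl {edge 1 2 \<one>, edge 1 2 x}}"

context
  fixes x assumes x: "x \<in> carrier \<Gamma>" "x \<noteq> \<one>"
begin

lemma rk_pair: "rk {edge 1 2 \<one>, edge 1 2 x} = 2"
  using parallel[of 1 2 \<one> x] x four_le by auto

lemma line_carrier: "line x \<subseteq> carrier \<Gamma>"
  by (auto simp: line_def)

lemma in_line: "\<one> \<in> line x" "x \<in> line x"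
  using subset_cl[of "{edge 1 2 \<one>, edge 1 2 x}"] x by (auto simp: line_def)

lemma R_line: "R (line x) \<le> 2"
proof -
  have "R (line x) \<le> rk {edge 1 2 \<one>, edge 1 2 x}"
    unfolding R_def using finite_image_edge[OF line_carrier] by (rule rk_le_cl) (auto simp: line_def)
  then show ?thesis unfolding rk_pair .
qed

text \<open>The rank is already \<open>2\<close> on \<open>\<one>\<close> and \<open>x\<close>, so
  no further element of \<open>A\<close> can raise it. This maximality is the source of all closure
  properties of lines.\<close>

lemma subset_line:
  assumes "A \<subseteq> carrier \<Gamma>" "\<one> \<in> A" "x \<in> A" "R A \<le> 2"
  shows "A \<subseteq> line x"
proof
  fix y assume y: "y \<in> A"
  let ?L = "{edge 1 2 \<one>, edge 1 2 x}"
  have "rk (insert (edge 1 2 y) ?L) \<le> R A"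
    unfolding R_def using assms(2,3) y by (intro rk_mono) auto
  moreover have "rk ?L \<le> rk (insert (edge 1 2 y) ?L)" by (intro rk_mono) auto
  ultimately have "edge 1 2 y \<in> cl ?L" using assms(4) rk_pair by (simp add: cl_def)
  then show "y \<in> line x" using y assms(1) by (auto simp: line_def)
qed

text \<open>Quotients of elements of the line form a set of rank at most \<open>2\<close> containing
  \<open>\<one>\<close> and \<open>x\<close>, so \<open>subset_line\<close> returns them to the
  line.\<close>

lemma subgroup_line: "subgroup (line x) \<Gamma>"
proof -
  let ?Q = "(\<lambda>(a, b). inv a \<otimes> b) ` (line x \<times> line x)"
  have Q: "inv a \<otimes> b \<in> ?Q" if "a \<in> line x" "b \<in> line x" for a b
    using that by (intro image_eqI[of _ _ "(a, b)"]) auto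
  have "\<one> \<in> ?Q" "x \<in> ?Q" using Q[OF in_line(1) in_line(1)] Q[OF in_line] x by simp_all
  moreover have "?Q \<subseteq> carrier \<Gamma>" using line_carrier by auto
  ultimately have "?Q \<subseteq> line x"
    using R_quotients[OF line_carrier in_line(1)] R_line by (intro subset_line) simp_all
  then have div: "inv a \<otimes> b \<in> line x" if "a \<in> line x" "b \<in> line x" for a b
    using Q[OF that] by blast
  have inv: "inv a \<in> line x" if "a \<in> line x" for a
    using div[OF that in_line(1)] that line_carrier by auto
  show ?thesis
  proof (rule subgroupI)
    fix a b assume ab: "a \<in> line x" "b \<in> line x"
    show "a \<otimes> b \<in> line x" using div[OF inv[OF ab(1)] ab(2)] ab line_carrier by auto
  qed (use inv in_line line_carrier in auto)
qed

text \<open>For the line \<open>L\<close>, the union of \<open>g L\<close> and \<open>L g\<close>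
  has rank at most \<open>2\<close>. Its right translate by \<open>inv g\<close> keeps this rank and
  contains \<open>L\<close>, in particular \<open>\<one>\<close> and \<open>x\<close>; hence all of
  it, including the conjugates, falls into \<open>L\<close>.\<close>

lemma normal_line: "line x \<lhd> \<Gamma>"
proof (rule normal_invI[OF subgroup_line])
  fix g h assume g: "g \<in> carrier \<Gamma>" and h: "h \<in> line x"
  let ?B = "(\<lambda>a. g \<otimes> a) ` line x \<union> (\<lambda>a. a \<otimes> g) ` line x"
  let ?C = "(\<lambda>a. a \<otimes> inv g) ` ?B"
  have B: "?B \<subseteq> carrier \<Gamma>" using g line_carrier by auto
  have "a \<in> ?C" if "a \<in> line x" for a
  proof -
    have "a = a \<otimes> g \<otimes> inv g" using that line_carrier g by (auto simp: m_assoc)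
    then show ?thesis using that by blast
  qed
  moreover have "R ?C \<le> 2"
    using R_mult[OF B inv_closed[OF g]] R_left_right[OF line_carrier in_line(1) g] R_line by linarith
  moreover have "?C \<subseteq> carrier \<Gamma>" using B g by auto
  ultimately have "?C \<subseteq> line x" using in_line by (intro subset_line) auto
  then show "g \<otimes> h \<otimes> inv g \<in> line x" using h by auto
qed

end

text \<open>Applying \<open>subset_line\<close> with \<open>y\<close> as generator gives one
  inclusion, which puts \<open>x\<close> on the line of \<open>y\<close> and so gives the
  other.\<close>

lemma line_eq:
  assumes "x \<in> carrier \<Gamma>" "x \<noteq> \<one>" "y \<in> line x" "y \<noteq> \<one>"
  shows "line x = line y"
proof
  have y: "y \<in> carrier \<Gamma>" using assms line_carrier by auto
  show sub: "line x \<subseteq> line y"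
    by (rule subset_line[OF y assms(4) line_carrier in_line(1) assms(3) R_line]) (use assms in auto)
  show "line y \<subseteq> line x"
    by (rule subset_line[OF assms(1,2) line_carrier in_line(1) _ R_line])
      (use assms sub y in_line(2) in auto)
qed

section \<open>The rank of the set of all edges\<close>

abbreviation edges :: "'e set" where
  "edges \<equiv> {edge i j a |i j a. i \<noteq> j \<and> {i, j} \<subseteq> {1..n} \<and> a \<in> carrier \<Gamma>}"

text \<open>All labels on \<open>12\<close> together with the \<open>n - 2\<close> spokes of gain
  \<open>\<one>\<close> from vertex \<open>1\<close> to the vertices \<open>3\<close> to
  \<open>n\<close> span every edge. Contrapositively, a large rank keeps a line from being the whole
  group.\<close>

lemma rk_edges_le:
  assumes "R (carrier \<Gamma>) \<le> 2"
  shows "rk edges \<le> n"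
proof -
  let ?F = "(\<lambda>k. edge 1 k \<one>) ` {3..n}"
  let ?X = "edge 1 2 ` carrier \<Gamma> \<union> ?F"
  have "rk ?X \<le> R (carrier \<Gamma>) + card ?F" unfolding R_def by (rule rk_Un_le) simp
  moreover have "card ?F \<le> card {3..n}" by (rule card_image_le) simp
  ultimately have X: "rk ?X \<le> n" using assms four_le by simp
  have base: "edge 1 2 a \<in> cl ?X" if "a \<in> carrier \<Gamma>" for a using that subset_cl[of ?X] by auto
  have spoke: "edge 1 k \<one> \<in> cl ?X" if "2 \<le> k" "k \<le> n" for k
  proof (cases "k = 2")
    case False
    then have "edge 1 k \<one> \<in> ?X" using that by auto
    then show ?thesis by (rule subsetD[OF subset_cl])
  qed (use base[OF one_closed] in simp)
  have from1: "edge 1 k a \<in> cl ?X" if k: "2 \<le> k" "k \<le> n" and a: "a \<in> carrier \<Gamma>" for k a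
  proof (cases "k = 2")
    case False
    \<comment> \<open>The way \<open>2 1 k\<close> puts the gain \<open>a\<close> on
      \<open>2k\<close>, and the way \<open>1 2 k\<close> carries it on to
      \<open>1k\<close>.\<close>
    have "edge 2 1 (inv (inv a)) \<in> cl ?X" using cl_inv[OF base[of "inv a"]] a by simp
    then have "edge 2 1 a \<in> cl ?X" using a by simp
    then have "edge 2 k (a \<otimes> \<one>) \<in> cl ?X" using spoke[OF k] a k False by (intro cl_mult[of 2 1]) auto
    then have "edge 2 k a \<in> cl ?X" using a by simp
    then have "edge 1 k (\<one> \<otimes> a) \<in> cl ?X"
      using base[OF one_closed] a k False by (intro cl_mult[of 1 2]) auto
    then show ?thesis using a by simp
  qed (use base[OF a] in simp)
  have to1: "edge k 1 a \<in> cl ?X" if k: "2 \<le> k" "k \<le> n" and a: "a \<in> carrier \<Gamma>" for k a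
    using cl_inv[OF from1[OF k, of "inv a"]] a k by simp
  have "edge i j a \<in> cl ?X" if ij: "i \<noteq> j" "{i, j} \<subseteq> {1..n}" and a: "a \<in> carrier \<Gamma>" for i j a
  proof -
    consider "i = 1" "2 \<le> j" | "j = 1" "2 \<le> i" | "2 \<le> i" "2 \<le> j" using ij by fastforce
    then show ?thesis
    proof cases
      case 3
      then have "edge i j (\<one> \<otimes> a) \<in> cl ?X"
        using ij a from1[of j a] to1[of i \<one>] by (intro cl_mult[of i 1]) auto
      then show ?thesis using a by simp
    qed (use ij a from1 to1 in auto)
  qed
  then have sub: "edges \<subseteq> cl ?X" by auto
  have "edges \<subseteq> (\<lambda>(i, j, a). edge i j a) ` ({1..n} \<times> {1..n} \<times> carrier \<Gamma>)" by force
  then have "finite edges" by (rule finite_subset) (simp add: finite_carrier)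
  then show ?thesis using rk_le_cl[OF _ sub] X by simp
qed

theorem elementary_abelian:
  assumes "rk edges > n" "carrier \<Gamma> \<noteq> {\<one>}"
  shows "\<exists>(p::nat) (j::nat). prime p \<and> j \<ge> 2 \<and> \<Gamma> \<cong> sum_group {..<j} (\<lambda>_. integer_mod_group p)"
proof (rule normal_partition_elementary_abelian[where P = "line ` (carrier \<Gamma> - {\<one>})"])
  \<comment> \<open>The identity lies on every line; \<open>g\<close> ensures that there is
    one.\<close>
  obtain g where g: "g \<in> carrier \<Gamma>" "g \<noteq> \<one>" using assms(2) one_closed by blast
  fix x assume "x \<in> carrier \<Gamma>"
  then show "\<exists>L\<in>line ` (carrier \<Gamma> - {\<one>}). x \<in> L"
    using in_line[of x] in_line[OF g] g by (cases "x = \<one>") blast+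
next
  fix L L'
  assume L: "L \<in> line ` (carrier \<Gamma> - {\<one>})" "L' \<in> line ` (carrier \<Gamma> - {\<one>})" "L \<noteq> L'"
  then obtain x x' where x: "x \<in> carrier \<Gamma>" "x \<noteq> \<one>" "L = line x"
    "x' \<in> carrier \<Gamma>" "x' \<noteq> \<one>" "L' = line x'"
    by auto
  have "y = \<one>" if y: "y \<in> L \<inter> L'" for y
  proof (rule ccontr)
    assume "y \<noteq> \<one>"
    then have "L = line y" "L' = line y"
      using line_eq[OF x(1,2), of y] line_eq[OF x(4,5), of y] x(3,6) y by blast+
    then show False using L(3) by simp
  qed
  moreover have "\<one> \<in> L \<inter> L'"
    unfolding x(3,6) using in_line(1)[OF x(1,2)] in_line(1)[OF x(4,5)] by blast
  ultimately show "L \<inter> L' = {\<one>}" by blast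
next
  show "carrier \<Gamma> \<notin> line ` (carrier \<Gamma> - {\<one>})"
  proof
    assume "carrier \<Gamma> \<in> line ` (carrier \<Gamma> - {\<one>})"
    then obtain x where x: "x \<in> carrier \<Gamma>" "x \<noteq> \<one>" and "carrier \<Gamma> = line x" by blast
    then have "R (carrier \<Gamma>) \<le> 2" using R_line[OF x] by metis
    then show False using rk_edges_le assms(1) by simp
  qed
qed (use normal_line finite_carrier assms(2) in auto)

end

section \<open>Lifts of the cycle matroid\<close>

text \<open>The rank is computed in \<open>K\<close>. Being free over \<open>X\<close> in the
  contraction, \<open>e\<close> raises the rank of \<open>X \<union> F\<close> in \<open>K\<close>,
  and by submodularity also that of \<open>X\<close>; on subsets of the common ground set the ranks
  in \<open>K\<close> and \<open>L\<close> agree.\<close>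

lemma lift_rk_insert:
  assumes lift: "is_lift L N" and e: "e \<in> ground N" "e \<notin> X" and X: "X \<subseteq> ground N"
    and free: "\<And>I. I \<in> indeps N \<Longrightarrow> I \<subseteq> X \<Longrightarrow> insert e I \<in> indeps N"
  shows "matroid.rk L (insert e X) = Suc (matroid.rk L X)"
proof -
  obtain K F where K: "matroid K" "ground K = ground N \<union> F" "ground N \<inter> F = {}"
    and N: "N = contraction K F" and L: "L = deletion K F" and mat: "matroid L" "matroid N"
    using lift unfolding is_lift_def by blast
  interpret L: matroid L by (rule mat)
  interpret N: matroid N by (rule mat)
  interpret K: matroid K by (rule K)
  have rk_L: "L.rk Y = K.rk Y" if "Y \<subseteq> ground N" for Y
  proof -
    have "{I \<in> indeps L. I \<subseteq> Y} = {I \<in> indeps K. I \<subseteq> Y}"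
      using that K(2,3) L by (auto simp: deletion_def)
    then show ?thesis by (simp add: L.rk_def K.rk_def)
  qed
  obtain I where I: "I \<in> indeps N" "I \<subseteq> X" "card I = N.rk X" by (rule N.rk_witness)
  obtain B where B: "basis_of K F B" "insert e I \<union> B \<in> indeps K"
    using free[OF I(1,2)] N by (auto simp: contraction_def)
  let ?J = "I \<union> B"
  have J: "?J \<in> indeps K" using K.indep_subset[OF B(2)] by blast
  have BF: "B \<subseteq> F" using B(1) by (simp add: basis_of_def)
  obtain J' where J': "J' \<in> indeps K" "?J \<subseteq> J'" "J' \<subseteq> X \<union> F" "card J' = K.rk (X \<union> F)"
    using K.indep_extend[OF J, of "X \<union> F"] I(2) BF by auto
  \<comment> \<open>\<open>?J\<close> is a basis of \<open>X \<union> F\<close>: a further element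
    of \<open>F\<close> would contradict the maximality of \<open>B\<close>, and one of
    \<open>X\<close> the maximality of \<open>I\<close> in the contraction.\<close>
  have "J' \<subseteq> ?J"
  proof
    fix x assume x: "x \<in> J'"
    show "x \<in> ?J"
    proof (cases "x \<in> F")
      case True
      have "insert x B \<in> indeps K" by (rule K.indep_subset[OF J'(1)]) (use x J'(2) in blast)
      then have "insert x B = B" using B(1) True BF unfolding basis_of_def by blast
      then show ?thesis by blast
    next
      case False
      then have xX: "x \<in> X" using x J'(3) by blast
      have "insert x I \<union> B \<in> indeps K" by (rule K.indep_subset[OF J'(1)]) (use x J'(2) in blast)
      moreover have "insert x I \<subseteq> ground K - F" using xX I(2) X K(2,3) by auto
      ultimately have "insert x I \<in> indeps N" using N B(1) by (auto simp: contraction_def)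
      then have "card (insert x I) \<le> card I" using N.card_le_rk[of "insert x I" X] xX I by simp
      then have "x \<in> I" using N.finite_indep[OF I(1)] by (cases "x \<in> I") auto
      then show ?thesis by blast
    qed
  qed
  then have rkJ: "card ?J = K.rk (X \<union> F)" using J' by auto
  have "e \<notin> ?J" using e I(2) BF K(3) by blast
  then have "Suc (card ?J) = card (insert e I \<union> B)" using K.finite_indep[OF J] by simp
  also have "\<dots> \<le> K.rk (insert e (X \<union> F))" using I(2) BF by (intro K.card_le_rk[OF B(2)]) auto
  finally have "Suc (K.rk X) \<le> K.rk (insert e X)"
    using K.rk_Un_insert_le[of X "X \<union> F" e] rkJ by simp
  then show ?thesis using rk_L[OF X] rk_L[of "insert e X"] K.rk_insert_le[of e X] X e by simp
qed

section \<open>Cuts and cycles\<close>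

definition crosses :: "('v, 'e) pre_digraph \<Rightarrow> 'v set \<Rightarrow> 'e \<Rightarrow> bool" where
  "crosses G S e \<longleftrightarrow> (tail G e \<in> S) \<noteq> (head G e \<in> S)"

lemma crosses_step: "crosses G S (fst x) \<longleftrightarrow> (step_start G x \<in> S) \<noteq> (step_end G x \<in> S)"
  by (cases x) (auto simp: crosses_def)

text \<open>If only step \<open>k\<close> crossed, the traversal would stay on the side where step
  \<open>k\<close> ends until it returns to the start of step \<open>k\<close>.\<close>

lemma cycle_crosses_twice:
  assumes w: "cycle_traversal G w" and k: "k < length w" "crosses G S (fst (w ! k))"
  shows "\<exists>l < length w. l \<noteq> k \<and> crosses G S (fst (w ! l))"
proof (rule ccontr)
  assume *: "\<not> ?thesis"
  have stay: "step_start G (w ! l) \<in> S \<longleftrightarrow> step_end G (w ! l) \<in> S" if "l < length w" "l \<noteq> k" for l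
    using that * by (auto simp: crosses_step)
  let ?n = "length w"
  have next_step: "step_end G (w ! l) = step_start G (w ! (Suc l mod ?n))" if "l < ?n" for l
    using w that by (simp add: cycle_traversal_def)
  \<comment> \<open>The index is \<open>Suc m\<close> steps after \<open>k\<close>, so
    \<open>m = length w - 1\<close> leads back to \<open>k\<close>.\<close>
  have "step_end G (w ! k) \<in> S \<longleftrightarrow> step_start G (w ! ((k + Suc m) mod ?n)) \<in> S" if "m < ?n" for m
    using that
  proof (induction m)
    case 0
    then show ?case using next_step[OF k(1)] by simp
  next
    case (Suc m)
    let ?l = "(k + Suc m) mod ?n"
    have l: "?l < ?n" using k(1) by (intro mod_less_divisor) linarith
    have "?l \<noteq> k"
      using Suc.prems k(1) by (cases "k + Suc m < ?n") (auto simp: le_mod_geq)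
    then have "step_start G (w ! ?l) \<in> S \<longleftrightarrow> step_end G (w ! ?l) \<in> S" by (rule stay[OF l])
    moreover have "Suc ?l mod ?n = (k + Suc (Suc m)) mod ?n" by (simp add: mod_Suc_eq)
    then have "step_end G (w ! ?l) = step_start G (w ! ((k + Suc (Suc m)) mod ?n))"
      using next_step[OF l] by (simp only:)
    moreover have "step_end G (w ! k) \<in> S \<longleftrightarrow> step_start G (w ! ?l) \<in> S"
      using Suc.prems by (intro Suc.IH) simp
    ultimately show ?case by (simp only:)
  qed
  moreover have "k + Suc (?n - 1) = k + ?n" using k(1) by simp
  then have "(k + Suc (?n - 1)) mod ?n = k" using k(1) by (simp only: mod_add_self2 mod_less)
  moreover have "?n - 1 < ?n" using k(1) by simp
  ultimately have "step_end G (w ! k) \<in> S \<longleftrightarrow> step_start G (w ! k) \<in> S"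
    by metis
  then show False using k(2) by (simp add: crosses_step)
qed

lemma cut_edge_not_in_cycle:
  assumes C: "is_cycle G C" and e: "e \<in> C" "crosses G S e"
    and others: "\<And>f. f \<in> C \<Longrightarrow> f \<noteq> e \<Longrightarrow> \<not> crosses G S f"
  shows False
proof -
  obtain w where w: "cycle_traversal G w" "C = set (map fst w)" using C by (auto simp: is_cycle_def)
  obtain k where k: "k < length w" "e = fst (w ! k)" using e(1) w(2) by (auto simp: in_set_conv_nth)
  obtain l where l: "l < length w" "l \<noteq> k" "crosses G S (fst (w ! l))"
    using cycle_crosses_twice[OF w(1) k(1)] e(2) k(2) by metis
  have "distinct (map fst w)" using w(1) by (simp add: cycle_traversal_def)
  then have "fst (w ! l) \<noteq> e" using k l by (metis length_map nth_eq_iff_index_eq nth_map)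
  moreover have "fst (w ! l) \<in> C" using l(1) w(2) by auto
  ultimately show False using others l(3) by blast
qed

text \<open>A new cycle would have \<open>e\<close> as its only edge across the cut. This supplies
  the assumption \<open>free\<close> of \<open>lift_rk_insert\<close>.\<close>

lemma cycle_matroid_insert_cut_edge:
  assumes I: "I \<in> indeps (cycle_matroid G)" and e: "e \<in> arcs G" "crosses G S e"
    and others: "\<And>f. f \<in> I \<Longrightarrow> \<not> crosses G S f"
  shows "insert e I \<in> indeps (cycle_matroid G)"
proof -
  have "\<not> is_cycle G C" if C: "C \<subseteq> insert e I" for C
  proof
    assume cyc: "is_cycle G C"
    show False
    proof (cases "e \<in> C")
      case True
      show False by (rule cut_edge_not_in_cycle[OF cyc True e(2)]) (use C others in blast)
    next
      case False
      then show False using C cyc I by (auto simp: cycle_matroid_def)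
    qed
  qed
  then show ?thesis using I e(1) by (auto simp: cycle_matroid_def)
qed

text \<open>Labels are stored for the orientation from the smaller to the larger endpoint, so a gain
  read from a larger \<open>i\<close> is inverted. Endpoints can then be given in the order of
  travel.\<close>

definition gain_edge :: "('a, 'b) monoid_scheme \<Rightarrow> nat \<Rightarrow> nat \<Rightarrow> 'a \<Rightarrow> nat set \<times> 'a" where
  "gain_edge \<Gamma> i j a = ({i, j}, if i < j then a else inv\<^bsub>\<Gamma>\<^esub> a)"

abbreviation gain_step :: "('a, 'b) monoid_scheme \<Rightarrow> nat \<Rightarrow> nat \<Rightarrow> 'a \<Rightarrow> (nat set \<times> 'a) \<times> bool" where
  "gain_step \<Gamma> i j a \<equiv> (gain_edge \<Gamma> i j a, i < j)"

lemma tail_head_gain_edge: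
  "tail (group_complete_graph n \<Gamma>) (gain_edge \<Gamma> i j a) = min i j"
  "head (group_complete_graph n \<Gamma>) (gain_edge \<Gamma> i j a) = max i j"
  by (simp_all add: group_complete_graph_def gain_edge_def)

lemma gain_step_start_end:
  fixes \<Gamma> :: "('a, 'b) monoid_scheme"
  assumes "i \<noteq> j"
  shows "step_start (group_complete_graph n \<Gamma>) (gain_step \<Gamma> i j a) = i"
    and "step_end (group_complete_graph n \<Gamma>) (gain_step \<Gamma> i j a) = j"
  using assms by (auto simp: tail_head_gain_edge)

lemma crosses_gain_edge:
  "crosses (group_complete_graph n \<Gamma>) S (gain_edge \<Gamma> i j a) \<longleftrightarrow> (i \<in> S) \<noteq> (j \<in> S)"
  by (auto simp: crosses_def tail_head_gain_edge min_def max_def)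

section \<open>Balanced triangles, parallel pairs and the star\<close>

context group
begin

lemma gain_step_label: "i \<noteq> j \<Longrightarrow> a \<in> carrier G \<Longrightarrow> step_label G (gain_step G i j a) = a"
  by (auto simp: gain_edge_def)

lemma gain_edge_reverse: "i \<noteq> j \<Longrightarrow> a \<in> carrier G \<Longrightarrow> gain_edge G j i (inv a) = gain_edge G i j a"
  by (auto simp: gain_edge_def insert_commute)

lemma gain_edge_in_arcs:
  "i \<noteq> j \<Longrightarrow> {i, j} \<subseteq> {1..n} \<Longrightarrow> a \<in> carrier G \<Longrightarrow> gain_edge G i j a \<in> arcs (group_complete_graph n G)"
  by (auto simp: gain_edge_def group_complete_graph_def)

lemma gain_edge_inj:
  "a \<in> carrier G \<Longrightarrow> b \<in> carrier G \<Longrightarrow> gain_edge G i j a = gain_edge G i j b \<longleftrightarrow> a = b"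
  by (auto simp: gain_edge_def)

lemma arcs_gain_edge:
  assumes "e \<in> arcs (group_complete_graph n G)"
  obtains i j a where "i \<noteq> j" "{i, j} \<subseteq> {1..n}" "a \<in> carrier G" "e = gain_edge G i j a"
proof -
  obtain s a where e: "e = (s, a)" "s \<subseteq> {1..n}" "card s = 2" "a \<in> carrier G"
    using assms by (auto simp: group_complete_graph_def)
  obtain i j where ij: "s = {i, j}" "i \<noteq> j" using e(3) by (auto simp: card_2_iff)
  show ?thesis
  proof (cases "i < j")
    case True
    then show ?thesis using that[of i j a] e ij by (simp add: gain_edge_def)
  next
    case False
    then show ?thesis using that[of j i a] e ij by (simp add: gain_edge_def insert_commute)
  qed
qed

lemma balanced_triangle:
  assumes d: "distinct [i, j, k]" and V: "{i, j, k} \<subseteq> {1..n}" and a: "a \<in> carrier G" and b: "b \<in> carrier G"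
  shows "balanced n G {gain_edge G i j a, gain_edge G j k b, gain_edge G i k (a \<otimes> b)}" (is "balanced n G ?C")
    and "is_cycle (group_complete_graph n G) {gain_edge G i j a, gain_edge G j k b, gain_edge G i k (a \<otimes> b)}"
proof -
  let ?G = "group_complete_graph n G"
  \<comment> \<open>The third edge is travelled from \<open>k\<close> back to \<open>i\<close>, so
    its gain \<open>inv (a \<otimes> b)\<close> closes the product to \<open>\<one>\<close>.\<close>
  let ?w = "[gain_step G i j a, gain_step G j k b, gain_step G k i (inv (a \<otimes> b))]"
  have ne: "i \<noteq> j" "j \<noteq> k" "k \<noteq> i" using d by auto
  have C: "?C = set (map fst ?w)" using a b ne by (simp add: gain_edge_reverse)
  have "distinct (map fst ?w)" using ne by (auto simp: gain_edge_def doubleton_eq_iff)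
  moreover have "set (map fst ?w) \<subseteq> arcs ?G"
    using V a b ne gain_edge_in_arcs by simp
  moreover have "step_end ?G (?w ! l) = step_start ?G (?w ! (Suc l mod length ?w))" if "l < length ?w" for l
  proof -
    have "l = 0 \<or> l = 1 \<or> l = 2" using that by auto
    then show ?thesis using ne by (elim disjE) (simp_all add: gain_step_start_end del: step_start.simps step_end.simps)
  qed
  moreover have "distinct (map (step_start ?G) ?w)"
    using ne by (simp add: gain_step_start_end del: step_start.simps)
  ultimately have w: "cycle_traversal ?G ?w" unfolding cycle_traversal_def by blast
  have "traversal_product G ?w = \<one>"
    using a b ne by (simp add: traversal_product_def gain_step_label m_assoc[symmetric] del: step_label.simps)
  then show "balanced n G ?C" unfolding balanced_def C using w by blast
  show "is_cycle ?G ?C" unfolding is_cycle_def C using w by blast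
qed

text \<open>For the second claim every traversal has to be excluded: it has two steps with different
  starting vertices, hence takes the edges in opposite directions, and its product is a quotient of
  distinct labels.\<close>

lemma parallel_pair:
  assumes ij: "i \<noteq> j" "{i, j} \<subseteq> {1..n}" and a: "a \<in> carrier G" and b: "b \<in> carrier G" and ab: "a \<noteq> b"
  shows "is_cycle (group_complete_graph n G) {gain_edge G i j a, gain_edge G i j b}" (is "is_cycle ?G ?C")
    and "\<not> balanced n G {gain_edge G i j a, gain_edge G i j b}"
proof -
  let ?w = "[gain_step G i j a, gain_step G j i (inv b)]"
  have C: "?C = set (map fst ?w)" using b ij(1) by (simp add: gain_edge_reverse)
  have ne: "gain_edge G i j a \<noteq> gain_edge G i j b" using gain_edge_inj[OF a b] ab by simp
  have "distinct (map fst ?w)" using ne b ij(1) by (simp add: gain_edge_reverse)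
  moreover have "set (map fst ?w) \<subseteq> arcs ?G"
    using ij a b gain_edge_in_arcs by simp
  moreover have "step_end ?G (?w ! l) = step_start ?G (?w ! (Suc l mod length ?w))" if "l < length ?w" for l
  proof -
    have "l = 0 \<or> l = 1" using that by auto
    then show ?thesis using ij(1) by (elim disjE) (simp_all add: gain_step_start_end del: step_start.simps step_end.simps)
  qed
  moreover have "distinct (map (step_start ?G) ?w)"
    using ij(1) by (simp add: gain_step_start_end del: step_start.simps)
  ultimately have w: "cycle_traversal ?G ?w" unfolding cycle_traversal_def by blast
  then show "is_cycle ?G ?C" unfolding is_cycle_def C by blast
  define c d where "c = (if i < j then a else inv a)" "d = (if i < j then b else inv b)"
  then have cd: "c \<in> carrier G" "d \<in> carrier G" "c \<noteq> d" "?C = {({i, j}, c), ({i, j}, d)}"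
    using a b ab by (auto simp: gain_edge_def)
  show "\<not> balanced n G ?C"
  proof
    assume "balanced n G ?C"
    then obtain w where w: "cycle_traversal ?G w" "?C = set (map fst w)" "traversal_product G w = \<one>"
      unfolding balanced_def by blast
    have dist: "distinct (map fst w)" "distinct (map (step_start ?G) w)"
      using w(1) by (auto simp: cycle_traversal_def)
    have "length w = card ?C" using distinct_card[OF dist(1)] w(2) by simp
    also have "\<dots> = 2" using cd by simp
    finally obtain x y where xy: "w = [x, y]" by (auto simp: length_Suc_conv numeral_2_eq_2)
    obtain c1 d1 c2 d2 where cd': "x = (({i, j}, c1), d1)" "y = (({i, j}, c2), d2)"
      "{c1, c2} = {c, d}"
      using w(2) unfolding xy cd(4) by (cases x; cases y) (auto simp: doubleton_eq_iff)
    have "d1 \<noteq> d2" using dist(2) unfolding xy cd'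
      by (cases d1; cases d2) (auto simp: group_complete_graph_def)
    moreover have c12: "c1 \<in> carrier G" "c2 \<in> carrier G" "c1 \<noteq> c2"
      using cd'(3) cd by (auto simp: doubleton_eq_iff)
    moreover have "step_label G x \<otimes> step_label G y = \<one>"
      using w(3) c12 unfolding xy cd' by (simp add: traversal_product_def)
    ultimately show False unfolding cd'
      by (cases d1; cases d2) (auto dest: inv_equality simp: inv_solve_right' inv_equality)
  qed
qed

text \<open>Each \<open>k\<close> is a leaf of the star, so its edge is the only one across the cut
  \<open>{k}\<close>. The star bounds the rank of the cycle matroid from below by
  \<open>n - 1\<close>.\<close>

lemma star_indep:
  "(\<lambda>k. gain_edge G 1 k \<one>) ` {2..n} \<in> indeps (cycle_matroid (group_complete_graph n G))"
proof -
  let ?T = "(\<lambda>k. gain_edge G 1 k \<one>) ` {2..n}" and ?G = "group_complete_graph n G"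
  have "\<not> is_cycle ?G C" if CT: "C \<subseteq> ?T" for C
  proof
    assume C: "is_cycle ?G C"
    then have "C \<noteq> {}" by (auto simp: is_cycle_def cycle_traversal_def)
    then obtain k where k: "k \<in> {2..n}" "gain_edge G 1 k \<one> \<in> C" using CT by blast
    show False
    proof (rule cut_edge_not_in_cycle[OF C k(2)])
      show "crosses ?G {k} (gain_edge G 1 k \<one>)" using k(1) by (simp add: crosses_gain_edge)
      fix f assume f: "f \<in> C" "f \<noteq> gain_edge G 1 k \<one>"
      then obtain l where "l \<in> {2..n}" "f = gain_edge G 1 l \<one>" using CT by blast
      then show "\<not> crosses ?G {k} f" using f k(1) by (auto simp: crosses_gain_edge)
    qed
  qed
  moreover have "?T \<subseteq> arcs ?G"
  proof
    fix e assume "e \<in> ?T"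
    then obtain k where "k \<in> {2..n}" "e = gain_edge G 1 k \<one>" by blast
    then show "e \<in> arcs ?G" using gain_edge_in_arcs[of 1 k n \<one>] by auto
  qed
  ultimately show ?thesis by (simp add: cycle_matroid_def)
qed

end

theorem theorem4p1:
  fixes n :: nat
    and \<Gamma> :: "('a, 'b) monoid_scheme"
    and M :: "(nat set \<times> 'a) pre_matroid"
  assumes "n \<ge> 4"
    and "group \<Gamma>"
    and "finite (carrier \<Gamma>)"
    and "\<not> trivial_group \<Gamma>"
    and "is_lift M (cycle_matroid (group_complete_graph n \<Gamma>))"
    and "\<And>C. is_cycle (group_complete_graph n \<Gamma>) C \<Longrightarrow> circuit M C \<longleftrightarrow> balanced n \<Gamma> C"
    and "int (matroid_rank M) - int (matroid_rank (cycle_matroid (group_complete_graph n \<Gamma>))) > 1"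
  shows "\<exists>(p :: nat) (j :: nat). prime p \<and> j \<ge> 2 \<and>
           \<Gamma> \<cong> sum_group {..<j} (\<lambda>_. integer_mod_group p)"
proof -
  let ?G = "group_complete_graph n \<Gamma>"
  let ?N = "cycle_matroid ?G"
  interpret group \<Gamma> by (rule assms)
  interpret M: matroid M using assms(5) by (simp add: is_lift_def)
  interpret N: matroid ?N using assms(5) by (simp add: is_lift_def)
  have ground: "ground M = arcs ?G" using assms(5) by (simp add: is_lift_def cycle_matroid_def)
  have bridge: "M.rk (insert (gain_edge \<Gamma> i j a) X) = Suc (M.rk X)"
    if ij: "i \<in> S" "j \<notin> S" "{i, j} \<subseteq> {1..n}" "a \<in> carrier \<Gamma>"
      and sub: "X \<subseteq> {gain_edge \<Gamma> k l b |k l b. k \<noteq> l \<and> {k, l} \<subseteq> {1..n} \<and> b \<in> carrier \<Gamma> \<and> (k \<in> S \<longleftrightarrow> l \<in> S)}"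
    for i j a S X
  proof (rule lift_rk_insert[OF assms(5)])
    have e: "gain_edge \<Gamma> i j a \<in> arcs ?G" using ij by (intro gain_edge_in_arcs) auto
    then show "gain_edge \<Gamma> i j a \<in> ground ?N" by (simp add: cycle_matroid_def)
    have X: "f \<in> arcs ?G \<and> \<not> crosses ?G S f" if f: "f \<in> X" for f
    proof -
      obtain k l b where "f = gain_edge \<Gamma> k l b" "k \<noteq> l" "{k, l} \<subseteq> {1..n}" "b \<in> carrier \<Gamma>" "k \<in> S \<longleftrightarrow> l \<in> S"
        using sub f by blast
      then show ?thesis using gain_edge_in_arcs by (simp add: crosses_gain_edge)
    qed
    then show "X \<subseteq> ground ?N" by (auto simp: cycle_matroid_def)
    have cross: "crosses ?G S (gain_edge \<Gamma> i j a)" using ij by (simp add: crosses_gain_edge)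
    then show "gain_edge \<Gamma> i j a \<notin> X" using X by blast
    show "insert (gain_edge \<Gamma> i j a) I \<in> indeps ?N" if "I \<in> indeps ?N" "I \<subseteq> X" for I
      by (rule cycle_matroid_insert_cut_edge[OF that(1) e cross]) (use X that in blast)
  qed
  \<comment> \<open>A bridge over the empty set has rank one, so no edge is a loop of
    \<open>M\<close>.\<close>
  have single: "{gain_edge \<Gamma> i j a} \<in> indeps M" if "i \<noteq> j" "{i, j} \<subseteq> {1..n}" "a \<in> carrier \<Gamma>" for i j a
    using bridge[of i "{i}" j a "{}"] that M.rk_indep[OF M.indep_empty] by (intro M.indep_if_rk) simp_all
  interpret gain_lift \<Gamma> M n "gain_edge \<Gamma>"
  proof unfold_locales
    show "n \<ge> 4" "finite (carrier \<Gamma>)" by (fact assms)+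
    show "gain_edge \<Gamma> j i (inv\<^bsub>\<Gamma>\<^esub> a) = gain_edge \<Gamma> i j a" if "a \<in> carrier \<Gamma>" "i \<noteq> j" for a i j
      using that by (rule gain_edge_reverse[rotated])
    show "gain_edge \<Gamma> i k (a \<otimes>\<^bsub>\<Gamma>\<^esub> b) \<in> M.cl {gain_edge \<Gamma> i j a, gain_edge \<Gamma> j k b}"
      if *: "distinct [i, j, k]" "{i, j, k} \<subseteq> {1..n}" "a \<in> carrier \<Gamma>" "b \<in> carrier \<Gamma>" for i j k a b
    proof -
      let ?T = "{gain_edge \<Gamma> i j a, gain_edge \<Gamma> j k b, gain_edge \<Gamma> i k (a \<otimes>\<^bsub>\<Gamma>\<^esub> b)}"
      have "circuit M ?T" using assms(6) balanced_triangle[OF *] by blast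
      then have "gain_edge \<Gamma> i k (a \<otimes>\<^bsub>\<Gamma>\<^esub> b) \<in> M.cl (?T - {gain_edge \<Gamma> i k (a \<otimes>\<^bsub>\<Gamma>\<^esub> b)})"
        by (rule M.circuit_in_cl) simp
      then show ?thesis by (rule subsetD[OF M.cl_mono, rotated]) auto
    qed
    show "M.rk {gain_edge \<Gamma> i j a, gain_edge \<Gamma> i j b} = 2"
      if *: "i \<noteq> j" "{i, j} \<subseteq> {1..n}" "a \<in> carrier \<Gamma>" "b \<in> carrier \<Gamma>" "a \<noteq> b" for i j a b
    proof -
      let ?e = "gain_edge \<Gamma> i j a" and ?f = "gain_edge \<Gamma> i j b"
      \<comment> \<open>Parallel edges with distinct gains form an unbalanced cycle, which is no
        circuit; as single edges are independent, so is the pair.\<close>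
      have "\<not> circuit M {?e, ?f}" using assms(6) parallel_pair[OF *] by blast
      moreover have "{?e, ?f} \<subseteq> ground M" using * gain_edge_in_arcs by (simp add: ground)
      moreover have "D \<in> indeps M" if "D \<subset> {?e, ?f}" for D
      proof -
        have "D \<subseteq> {?e} \<or> D \<subseteq> {?f}" using that by blast
        then show ?thesis using M.indep_subset single * by meson
      qed
      ultimately have "{?e, ?f} \<in> indeps M" unfolding circuit_def by blast
      then show ?thesis using M.rk_indep gain_edge_inj * by simp
    qed
  qed (fact bridge)
  let ?T = "(\<lambda>k. gain_edge \<Gamma> 1 k \<one>\<^bsub>\<Gamma>\<^esub>) ` {2..n}"
  have "inj_on (\<lambda>k. gain_edge \<Gamma> 1 k \<one>\<^bsub>\<Gamma>\<^esub>) {2..n}"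
    by (auto simp: inj_on_def gain_edge_def doubleton_eq_iff)
  then have "n - 1 = card ?T" by (simp add: card_image)
  also have "\<dots> \<le> matroid_rank ?N"
    unfolding N.matroid_rank_eq_rk using N.indep_subset_ground[OF star_indep] by (intro N.card_le_rk star_indep)
  \<comment> \<open>The rank of \<open>M\<close> exceeds that of the cycle matroid by at least
    \<open>2\<close>, hence is at least \<open>n + 1\<close>.\<close>
  finally have "n < matroid_rank M" using assms(1,7) by simp
  also have "\<dots> \<le> M.rk edges"
    unfolding M.matroid_rank_eq_rk ground by (intro M.rk_mono subsetI) (erule arcs_gain_edge, blast)
  finally show ?thesis using elementary_abelian assms(4) by (auto simp: trivial_group_def is_group)
qed

end
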